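(* Let $T>0$. Let $\phi\colon\mathbb{R}\to\mathbb{R}$ be an increasing homeomorphism with $\phi(\mathbb{R})=\mathbb{R}$ and $\phi(0)=0$, let $f,q\colon\mathbb{R}\to\mathbb{R}$ be continuous, and let $a,e\in L^{\infty}(0,T)$ with $a(t)\ge 0$ for a.e. $t\in[0,T]$, $\frac1T\int_0^T a(t)\,dt=1$ and $\frac1T\int_0^T e(t)\,dt=0$. Assume $\lim_{u\to-\infty}q(u)=\lim_{u\to+\infty}q(u)=\omega\in\mathbb{R}$ and $q(u)>\omega$ for all $|u|$ sufficiently large. For $s\in\mathbb{R}$ consider $$(\phi(u'))'+f(u)u'+a(t)q(u)=s+e(t). \qquad (\mathscr{W\!E}_s)$$ Then there exists $s_0\in\,]\omega,+\infty[$ such that: for $s>s_0$, $(\mathscr{W\!E}_s)$ has no $T$-periodic solutions; for $s=s_0$, it has at least one $T$-periodic solution; for $\omega<s<s_0$, it has at least two $T$-periodic solutions. Moreover, if $q(u)>\omega$ for all $u\in\mathbb{R}$, then for $s\le\omega$ equation $(\mathscr{W\!E}_s)$ has no $T$-periodic solutions.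
   Context: A $T$-periodic solution of $(\mathscr{W\!E}_s)$ is a function $u\in\mathcal{C}^1([0,T])$ with $u(0)=u(T)$, $u'(0)=u'(T)$, such that $\phi(u')$ is absolutely continuous and the equation holds for a.e. $t\in[0,T]$. *)

theory Defs
  imports "HOL-Analysis.Analysis"
begin

definition abs_continuous_on :: "real set \<Rightarrow> (real \<Rightarrow> real) \<Rightarrow> bool" where
  "abs_continuous_on S g \<longleftrightarrow>
     (\<forall>\<epsilon>>0. \<exists>\<delta>>0. \<forall>(n::nat) (x::nat \<Rightarrow> real) (y::nat \<Rightarrow> real).
        (\<forall>i<n. x i \<le> y i \<and> {x i..y i} \<subseteq> S) \<longrightarrow>
        (\<forall>i<n. \<forall>j<n. i \<noteq> j \<longrightarrow> {x i<..<y i} \<inter> {x j<..<y j} = {}) \<longrightarrow>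
        (\<Sum>i<n. y i - x i) < \<delta> \<longrightarrow>
        (\<Sum>i<n. \<bar>g (y i) - g (x i)\<bar>) < \<epsilon>)"

definition Linf_on :: "real \<Rightarrow> (real \<Rightarrow> real) \<Rightarrow> bool" where
  "Linf_on T g \<longleftrightarrow> set_borel_measurable lebesgue {0..T} g \<and>
     (\<exists>B. AE t in lebesgue. t \<in> {0..T} \<longrightarrow> \<bar>g t\<bar> \<le> B)"

definition periodic_solution ::
  "(real \<Rightarrow> real) \<Rightarrow> (real \<Rightarrow> real) \<Rightarrow> (real \<Rightarrow> real) \<Rightarrow> (real \<Rightarrow> real) \<Rightarrow>
   (real \<Rightarrow> real) \<Rightarrow> real \<Rightarrow> real \<Rightarrow> (real \<Rightarrow> real) \<Rightarrow> bool" where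
  "periodic_solution \<phi> f a q e T s u \<longleftrightarrow>
     (\<exists>u'. (\<forall>t\<in>{0..T}. (u has_real_derivative u' t) (at t within {0..T})) \<and>
           continuous_on {0..T} u' \<and>
           u 0 = u T \<and> u' 0 = u' T \<and>
           abs_continuous_on {0..T} (\<lambda>t. \<phi> (u' t)) \<and>
           (AE t in lebesgue. t \<in> {0..T} \<longrightarrow>
              ((\<lambda>t. \<phi> (u' t)) has_real_derivative
                 (s + e t - f (u t) * u' t - a t * q (u t))) (at t within {0..T})))"

end

(* Put psi = phi^-1, let F be a primitive of f and E(t) the integral of e over [0,t]. A function u solves
   the equation with parameter s iff u(0) = u(T), s is the mean of a q(u), and, for some constant c,
   u' = psi (c + s t - (integral of a q(u) over [0,t]) - F(u) + E(t)).
   Multiplying phi(u') by u' bounds the oscillation of every solution.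

   Fix a continuous alpha. For each prescribed value r of min (u - alpha), Schauder's theorem yields a
   solution for some parameter s, and letting r vary in an interval as an additional unknown it yields
   one for a given s, provided that the parameters found at the two endpoints of the interval lie on
   different sides of s. Since q tends to omega at infinity, the parameter is below any given
   s > omega when |r| is large. If alpha is itself a solution with parameter s0, it is at least s0 at r = 0,
   because there u touches alpha from above. So every s between omega and s0 is attained both for some
   r > 0 and for some r < 0. The value s0 is the largest mean of a q(u) over all solutions u; it
   is attained by compactness. *)
theory Submission
  imports Defs "HOL-Complex_Analysis.Great_Picard"
begin

text \<open>A solution with prescribed minimum r need not be unique, so its parameter is not a
  function of r to which the intermediate value theorem could be applied. This is why r is itself an
  unknown: in the fixed point problem it is pushed by \<open>p * (sig w - \<sigma>)\<close> and
  clamped to its interval, and the sign of \<open>p\<close> is chosen so that the push points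
  inwards at both ends. The operator contains \<open>sig w\<close> in place of s. Then s + e - a
  q(w) has mean zero for every w, and u'(0) = u'(T) follows from u(0) = u(T). The constant c is a
  further unknown, determined by the condition that u' has integral zero. Schauder's theorem needs
  bounds, while F may be unbounded, so F is truncated first. The truncation can be undone because
  the oscillation bound is the same for every function put in the place of F. Since phi(u') is
  differentiable only almost everywhere, derivatives of phi(u') cannot be compared at a touching
  point. The comparison at r = 0 uses the integrated equation on a short interval to the right of
  that point.\<close>

hide_const (open) Polynomial.content

section \<open>Schauder's fixed point theorem\<close>

text \<open>An approximate Brouwer theorem. The dimension \<open>n\<close> is a number that depends
  on a net chosen later, so points are functions on all of \<open>nat\<close>. The cube is then a
  countable product of intervals, compact in the product topology, and the grid points used vanish
  from coordinate \<open>n\<close> on.\<close>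

lemma kuhn_approximate_fixpoint:
  fixes g :: "(nat \<Rightarrow> real) \<Rightarrow> nat \<Rightarrow> real"
  assumes maps: "\<And>x i. \<forall>j. x j \<in> {0..1} \<Longrightarrow> g x i \<in> {0..1}"
    and cont: "\<And>i. i < n \<Longrightarrow> continuous_on (UNIV \<rightarrow> {0..1}) (\<lambda>x. g x i)"
    and "\<epsilon> > 0"
  obtains x where "\<forall>j. x j \<in> {0..1}" "\<And>i. i < n \<Longrightarrow> \<bar>g x i - x i\<bar> \<le> \<epsilon>"
proof -
  let ?C = "UNIV \<rightarrow> {0..1::real}"
  have compactC: "compact ?C"
    using compactin_PiE[of "\<lambda>_. euclidean" UNIV "\<lambda>_. {0..1::real}"]
    by (simp add: euclidean_product_topology PiE_UNIV_domain)
  have "\<exists>d>0. \<forall>x\<in>?C. \<forall>y\<in>?C. dist x y < d \<longrightarrow> (\<forall>i<n. \<bar>g x i - g y i\<bar> < \<epsilon>/2)"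
  proof -
    have "\<exists>d>0. \<forall>x\<in>?C. \<forall>y\<in>?C. dist x y < d \<longrightarrow> \<bar>g x i - g y i\<bar> < \<epsilon>/2" if "i < n" for i
      using compact_uniformly_continuous[OF cont[OF that] compactC] \<open>\<epsilon> > 0\<close>
      unfolding uniformly_continuous_on_def dist_real_def
      by (metis dist_commute half_gt_zero)
    then obtain D where D: "\<And>i. i < n \<Longrightarrow> D i > 0"
      "\<And>i x y. i < n \<Longrightarrow> x \<in> ?C \<Longrightarrow> y \<in> ?C \<Longrightarrow> dist x y < D i \<Longrightarrow> \<bar>g x i - g y i\<bar> < \<epsilon>/2"
      by metis
    show ?thesis
      by (rule exI[of _ "Min (insert 1 (D ` {..<n}))"]) (use D in \<open>auto simp: less_eq_real_def\<close>)
  qed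
  then obtain d where "d > 0"
    and d: "\<And>x y i. x \<in> ?C \<Longrightarrow> y \<in> ?C \<Longrightarrow> dist x y < d \<Longrightarrow> i < n \<Longrightarrow> \<bar>g x i - g y i\<bar> < \<epsilon>/2"
    by metis
  \<comment> \<open>The product metric is at most twice the largest difference among finitely many
    coordinates plus a geometric tail, which gives less than \<open>d/2 + d/4\<close>.\<close>
  have dist_small: "dist x y < d" if "\<And>i. \<bar>x i - y i\<bar> \<le> d/4" for x y :: "nat \<Rightarrow> real"
  proof -
    obtain N where N: "(1/2)^N < d/4"
      using real_arch_pow_inv[of "d/4" "1/2"] \<open>d > 0\<close> by auto
    have "Max {dist (x (from_nat n)) (y (from_nat n))|n. n \<le> N} \<le> d/4"
      by (subst Max_le_iff) (use that in \<open>auto simp: dist_real_def\<close>)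
    then show ?thesis
      using dist_fun_le_dist_first_terms[of x y N] N \<open>d > 0\<close> by linarith
  qed
  obtain p :: nat where p: "real p > max (4/d) (2/\<epsilon>)"
    using reals_Archimedean2 by blast
  then have p0: "p > 0"
    using \<open>d > 0\<close> by (auto intro!: Nat.gr0I)
  with p have pd: "1 / real p \<le> d/4" and pe: "1 / real p \<le> \<epsilon>/2"
    using \<open>d > 0\<close> \<open>\<epsilon> > 0\<close> by (auto simp: field_simps)
  define X where "X x i = (if i < n then real (x i) / real p else 0)" for x :: "nat \<Rightarrow> nat" and i
  \<comment> \<open>Label 0 says that \<open>g\<close> does not decrease coordinate
    \<open>i\<close>, label 1 that \<open>g\<close> does not increase it. Kuhn's lemma prescribes
    the labels on opposite faces; as \<open>g\<close> takes values in [0,1], the prescribed labels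
    fit this reading.\<close>
  define label where "label x i =
     (if x i = 0 then 0 else if x i = p then 1 else if X x i \<le> g (X x) i then 0 else (1::nat))"
     for x :: "nat \<Rightarrow> nat" and i
  have XC: "X x \<in> ?C" if "\<forall>i<n. x i \<le> p" for x
    using that p0 by (auto simp: X_def)
  have X0: "X x i \<le> g (X x) i" if "\<forall>i<n. x i \<le> p" "i < n" "label x i = 0" for x i
    using that XC[OF that(1)] maps[of "X x" i] p0 by (auto simp: label_def X_def Pi_iff split: if_splits)
  have X1: "g (X x) i \<le> X x i" if "\<forall>i<n. x i \<le> p" "i < n" "label x i \<noteq> 0" for x i
    using that XC[OF that(1)] maps[of "X x" i] p0 by (auto simp: label_def X_def Pi_iff split: if_splits)
  obtain q where q: "\<forall>i<n. q i < p"
    and rs: "\<forall>i<n. \<exists>r s. (\<forall>j<n. q j \<le> r j \<and> r j \<le> q j + 1) \<and>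
               (\<forall>j<n. q j \<le> s j \<and> s j \<le> q j + 1) \<and> label r i \<noteq> label s i"
    by (rule kuhn_lemma[of p n label]) (use p0 in \<open>auto simp: label_def\<close>)
  have qp: "\<forall>i<n. q i \<le> p"
    using q by auto
  show thesis
  proof (rule that[of "X q"])
    show "\<forall>j. X q j \<in> {0..1}"
      using XC[OF qp] by auto
    fix i assume i: "i < n"
    have close: "\<bar>X r j - X q j\<bar> \<le> 1 / real p \<and> X q j \<le> X r j"
      if "\<forall>j<n. q j \<le> r j \<and> r j \<le> q j + 1" for r j
    proof (cases "j < n")
      case True
      with that have "real (q j) \<le> real (r j)" "real (r j) \<le> real (q j) + 1"
        by force+
      moreover have "X r j - X q j = (real (r j) - real (q j)) / real p"
        using True by (simp add: X_def diff_divide_distrib)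
      ultimately have "0 \<le> X r j - X q j" "X r j - X q j \<le> 1 / real p"
        using p0 by (auto intro!: divide_right_mono)
      then show ?thesis
        by linarith
    qed (use p0 in \<open>auto simp: X_def\<close>)
    have gclose: "\<bar>g (X r) i - g (X q) i\<bar> < \<epsilon>/2" "\<forall>j<n. r j \<le> p"
      if "\<forall>j<n. q j \<le> r j \<and> r j \<le> q j + 1" for r
    proof -
      show *: "\<forall>j<n. r j \<le> p"
        using that q by fastforce
      have "dist (X r) (X q) < d"
        using close[OF that] pd by (intro dist_small) (meson order_trans)
      then show "\<bar>g (X r) i - g (X q) i\<bar> < \<epsilon>/2"
        using d[OF XC XC] * qp i by blast
    qed
    obtain r s where r: "\<forall>j<n. q j \<le> r j \<and> r j \<le> q j + 1"
      and s: "\<forall>j<n. q j \<le> s j \<and> s j \<le> q j + 1" and lr: "label r i = 0" and ls: "label s i \<noteq> 0"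
    proof -
      obtain r s where *: "\<forall>j<n. q j \<le> r j \<and> r j \<le> q j + 1" "\<forall>j<n. q j \<le> s j \<and> s j \<le> q j + 1"
        "label r i \<noteq> label s i"
        using rs i by blast
      have "label r i = 0 \<or> label r i = 1" "label s i = 0 \<or> label s i = 1"
        by (auto simp: label_def)
      with * that[of r s] that[of s r] show thesis
        by auto
    qed
    \<comment> \<open>\<open>r\<close> and \<open>s\<close> are corners of the grid cube at
      \<open>q\<close>, so uniform continuity transfers the two opposite inequalities to
      \<open>X q\<close> up to \<open>\<epsilon>\<close>.\<close>
    have "X r i \<le> g (X r) i" "g (X s) i \<le> X s i"
      using X0[OF gclose(2)[OF r] i lr] X1[OF gclose(2)[OF s] i ls] .
    then show "\<bar>g (X q) i - X q i\<bar> \<le> \<epsilon>"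
      using gclose(1)[OF r] gclose(1)[OF s] close[OF r, of i] close[OF s, of i] pe by linarith
  qed
qed

text \<open>Reduction to a finite-dimensional cube: \<open>z\<close> sends a point of the cube to a
  convex combination of a finite net \<open>y\<close>, and \<open>g\<close> reads off the weights of
  \<open>f (z x)\<close> in a partition of unity \<open>\<nu>\<close> subordinate to that net. An
  approximate fixed point of \<open>g\<close> gives a point of \<open>S\<close> that
  \<open>f\<close> hardly moves, and by compactness the displacement attains its minimum, which must
  be 0.\<close>

theorem schauder_fixpoint:
  fixes f :: "'a::real_normed_vector \<Rightarrow> 'a"
  assumes "compact S" "convex S" "S \<noteq> {}" and contf: "continuous_on S f" and fim: "\<And>x. x \<in> S \<Longrightarrow> f x \<in> S"
  obtains x where "x \<in> S" "f x = x"
proof -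
  have approx: "\<exists>x\<in>S. dist (f x) x \<le> 2 * \<epsilon>" if "\<epsilon> > 0" for \<epsilon>
  proof -
    obtain K where K: "K \<subseteq> S" "finite K" "S \<subseteq> (\<Union>x\<in>K. ball x \<epsilon>)"
      by (rule compactE_image[OF \<open>compact S\<close>, of S "\<lambda>x. ball x \<epsilon>"]) (use \<open>\<epsilon> > 0\<close> in auto)
    define n where "n = card K"
    obtain y where y: "bij_betw y {..<n} K"
      using ex_bij_betw_nat_finite[OF K(2)] unfolding n_def atLeast0LessThan by blast
    have "K \<noteq> {}"
      using K \<open>S \<noteq> {}\<close> by auto
    then have "n > 0"
      using K(2) by (simp add: n_def card_gt_0_iff)
    have yS: "y i \<in> S" if "i < n" for i
      using that y K(1) by (auto simp: bij_betw_def)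
    define \<mu> where "\<mu> i v = max 0 (\<epsilon> - dist v (y i))" for i v
    define \<nu> where "\<nu> i v = \<mu> i v / (\<Sum>j<n. \<mu> j v)" for i v
    have mu_nonneg: "\<mu> i v \<ge> 0" for i v
      by (simp add: \<mu>_def)
    have mu_pos: "(\<Sum>j<n. \<mu> j v) > 0" if v: "v \<in> S" for v
    proof -
      obtain j where "j < n" "dist (y j) v < \<epsilon>"
        using K(3) v y unfolding bij_betw_def by force
      then have "\<mu> j v > 0"
        by (simp add: \<mu>_def dist_commute)
      with \<open>j < n\<close> mu_nonneg show ?thesis
        by (intro sum_pos2[of _ j]) auto
    qed
    have nu_sum: "(\<Sum>i<n. \<nu> i v) = 1" if "v \<in> S" for v
      using mu_pos[OF that] by (simp add: \<nu>_def flip: sum_divide_distrib)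
    have nu_nonneg: "\<nu> i v \<ge> 0" for i v
      using mu_nonneg by (simp add: \<nu>_def sum_nonneg)
    have nu_le: "\<nu> i v \<le> 1" if "v \<in> S" "i < n" for i v
      using nu_sum[OF that(1)] member_le_sum[of i "{..<n}" "\<lambda>i. \<nu> i v"] nu_nonneg that(2) by auto
    have nu_cont: "continuous_on S (\<nu> i)" for i
      unfolding \<nu>_def \<mu>_def
      by (intro continuous_intros) (use mu_pos in \<open>force simp: \<mu>_def\<close>)
    \<comment> \<open>Weights defined on the whole cube, which are just the coordinates where these add up to 1.\<close>
    define wt where "wt i x = (x i + (if i = 0 then max 0 (1 - (\<Sum>j<n. x j)) else 0)) / max 1 (\<Sum>j<n. x j)"
      for i and x :: "nat \<Rightarrow> real"
    define z where "z x = (\<Sum>i<n. wt i x *\<^sub>R y i)" for x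
    let ?C = "UNIV \<rightarrow> {0..1::real}"
    have lam_sum: "(\<Sum>i<n. wt i x) = 1" for x
    proof -
      have "(\<Sum>i<n. x i + (if i = 0 then max 0 (1 - (\<Sum>j<n. x j)) else 0)) = max 1 (\<Sum>j<n. x j)"
        using \<open>n > 0\<close> by (simp add: sum.distrib sum.delta)
      then show ?thesis
        by (simp add: wt_def flip: sum_divide_distrib)
    qed
    have zS: "z x \<in> S" if "x \<in> ?C" for x
      unfolding z_def
      by (rule convex_sum[OF _ \<open>convex S\<close> lam_sum]) (use yS that in \<open>auto simp: wt_def Pi_iff\<close>)
    have sum_cont: "continuous_on ?C (\<lambda>x. \<Sum>j<n. x j)"
      by (intro continuous_intros continuous_on_subset[OF continuous_on_product_coordinates]) auto
    have "continuous_on ?C (wt i)" for i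
      unfolding wt_def using continuous_on_subset[OF continuous_on_product_coordinates[of i], of ?C]
      by (cases "i = 0") (auto intro!: continuous_intros sum_cont)
    then have z_cont: "continuous_on ?C z"
      unfolding z_def by (intro continuous_intros)
    define g where "g x i = (if i < n then \<nu> i (f (z x)) else 0)" for x i
    have g01: "g x i \<in> {0..1}" if "\<forall>j. x j \<in> {0..1}" for x i
      using nu_nonneg nu_le[OF fim[OF zS]] that by (simp add: g_def Pi_iff)
    have g_cont: "continuous_on ?C (\<lambda>x. g x i)" if "i < n" for i
    proof -
      have "continuous_on ?C (\<lambda>x. \<nu> i (f (z x)))"
        by (rule continuous_on_compose2[OF nu_cont] continuous_on_compose2[OF contf] z_cont)+
          (use zS fim in auto)
      then show ?thesis
        using that by (simp add: g_def)
    qed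
    define Y where "Y = (\<Sum>i<n. norm (y i))"
    have "Y \<ge> 0"
      by (simp add: Y_def sum_nonneg)
    \<comment> \<open>An error of \<open>(2 * n + 1) * \<eta>\<close> in every weight moves the
      combination of the \<open>y i\<close> by at most \<open>\<epsilon>\<close>; the final 1 keeps
      the denominator positive when \<open>Y = 0\<close>.\<close>
    define \<eta> where "\<eta> = \<epsilon> / ((2 * n + 1) * Y + 1)"
    have "(2 * n + 1) * Y + 1 > 0"
      using \<open>Y \<ge> 0\<close> by (simp add: add_nonneg_pos)
    then have "\<eta> > 0" and eta: "(2 * n + 1) * \<eta> * Y \<le> \<epsilon>"
      using \<open>\<epsilon> > 0\<close> by (auto simp: \<eta>_def field_simps)
    obtain x where x: "\<forall>j. x j \<in> {0..1}" and gx: "\<And>i. i < n \<Longrightarrow> \<bar>g x i - x i\<bar> \<le> \<eta>"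
      using kuhn_approximate_fixpoint[of g n \<eta>] g01 g_cont \<open>\<eta> > 0\<close> by blast
    have zx: "z x \<in> S" and w: "f (z x) \<in> S"
      using zS[of x] fim x by auto
    define w where "w = f (z x)"
    define s where "s = (\<Sum>j<n. x j)"
    have nu_x: "\<bar>\<nu> i w - x i\<bar> \<le> \<eta>" if "i < n" for i
      using gx[OF that] that by (simp add: g_def w_def)
    have "\<bar>1 - s\<bar> = \<bar>\<Sum>i<n. \<nu> i w - x i\<bar>"
      using nu_sum[OF w] by (simp add: w_def s_def sum_subtractf)
    also have "\<dots> \<le> (\<Sum>i<n. \<eta>)"
      by (rule order_trans[OF sum_abs sum_mono]) (use nu_x in auto)
    finally have s1: "\<bar>1 - s\<bar> \<le> n * \<eta>"
      by simp
    \<comment> \<open>One \<open>\<eta>\<close> comes from the approximate fixed point,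
      \<open>n * \<eta>\<close> from the deficit added to coordinate 0, and
      \<open>n * \<eta>\<close> from the division by \<open>m\<close>. The last two are small
      because the coordinates of \<open>x\<close> almost add up to 1.\<close>
    have lam_nu: "\<bar>wt i x - \<nu> i w\<bar> \<le> (2 * n + 1) * \<eta>" if "i < n" for i
    proof -
      define num where "num = x i + (if i = 0 then max 0 (1 - s) else 0)"
      define m where "m = max 1 s"
      have lam: "wt i x = num / m"
        by (simp add: wt_def num_def m_def s_def)
      have "wt j x \<ge> 0" for j
        using x by (auto simp: wt_def)
      then have "wt i x \<le> 1"
        using lam_sum[of x] member_le_sum[of i "{..<n}" "\<lambda>i. wt i x"] that by auto
      moreover have "wt i x \<ge> 0" by fact
      moreover have "num = wt i x * m" "m \<ge> 1" "m - 1 \<le> n * \<eta>"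
        using s1 \<open>\<eta> > 0\<close> by (auto simp: lam m_def)
      ultimately have "\<bar>num - wt i x\<bar> \<le> n * \<eta>"
        using mult_mono[of "wt i x" 1 "m - 1" "n * \<eta>"]
          mult_nonneg_nonneg[of "wt i x" "m - 1"] by (simp add: algebra_simps)
      moreover have "\<bar>num - x i\<bar> \<le> n * \<eta>"
        using s1 \<open>\<eta> > 0\<close> by (auto simp: num_def)
      ultimately show ?thesis
        using nu_x[OF that] by (simp add: algebra_simps)
    qed
    have "norm (z x - (\<Sum>i<n. \<nu> i w *\<^sub>R y i)) = norm (\<Sum>i<n. (wt i x - \<nu> i w) *\<^sub>R y i)"
      by (simp add: z_def scaleR_diff_left sum_subtractf)
    also have "\<dots> \<le> (\<Sum>i<n. (2 * n + 1) * \<eta> * norm (y i))"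
      by (rule sum_norm_le) (use lam_nu in \<open>auto intro!: mult_right_mono\<close>)
    also have "\<dots> \<le> \<epsilon>"
      using eta by (simp add: Y_def sum_distrib_left)
    finally have 1: "norm (z x - (\<Sum>i<n. \<nu> i w *\<^sub>R y i)) \<le> \<epsilon>" .
    have "(\<Sum>i<n. \<nu> i w *\<^sub>R y i) - w = (\<Sum>i<n. \<nu> i w *\<^sub>R (y i - w))"
      using nu_sum[OF w] by (simp add: w_def scaleR_diff_right sum_subtractf flip: scaleR_left.sum)
    also have "norm \<dots> \<le> (\<Sum>i<n. \<nu> i w * \<epsilon>)"
    proof (rule sum_norm_le)
      fix i
      have "\<nu> i w = 0 \<or> norm (y i - w) \<le> \<epsilon>"
        by (auto simp: \<nu>_def \<mu>_def dist_norm norm_minus_commute)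
      then show "norm (\<nu> i w *\<^sub>R (y i - w)) \<le> \<nu> i w * \<epsilon>"
        using nu_nonneg[of i w] by (auto intro: mult_left_mono)
    qed
    also have "\<dots> = \<epsilon>"
      using nu_sum[OF w] by (simp add: w_def flip: sum_distrib_right)
    finally have 2: "norm ((\<Sum>i<n. \<nu> i w *\<^sub>R y i) - w) \<le> \<epsilon>" .
    have "dist w (z x) \<le> 2 * \<epsilon>"
      using norm_triangle_ineq[of "z x - (\<Sum>i<n. \<nu> i w *\<^sub>R y i)" "(\<Sum>i<n. \<nu> i w *\<^sub>R y i) - w"] 1 2
      by (simp add: dist_norm norm_minus_commute)
    then show ?thesis
      using zx by (auto simp: w_def)
  qed
  obtain x where x: "x \<in> S" and xmin: "\<And>y. y \<in> S \<Longrightarrow> dist (f x) x \<le> dist (f y) y"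
    using continuous_attains_inf[OF \<open>compact S\<close> \<open>S \<noteq> {}\<close>
        continuous_on_dist[OF contf continuous_on_id]]
    by auto
  have "dist (f x) x = 0"
  proof (rule ccontr)
    assume "dist (f x) x \<noteq> 0"
    then obtain y where "y \<in> S" "dist (f y) y \<le> 2 * (dist (f x) x / 4)"
      using approx[of "dist (f x) x / 4"] by auto
    then show False
      using xmin[of y] \<open>dist (f x) x \<noteq> 0\<close> zero_le_dist[of "f x" x] by linarith
  qed
  then show thesis
    using that x by auto
qed

section \<open>Absolutely continuous functions and indefinite integrals\<close>

lemma abs_continuous_on_subset:
  assumes "abs_continuous_on S g" "R \<subseteq> S"
  shows "abs_continuous_on R g"
  unfolding abs_continuous_on_def
proof (intro allI impI)
  fix \<epsilon> :: real assume "\<epsilon> > 0"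
  obtain \<delta> where "\<delta> > 0"
    and \<delta>: "\<forall>(n::nat) x y. (\<forall>i<n. x i \<le> y i \<and> {x i..y i} \<subseteq> S) \<longrightarrow>
        (\<forall>i<n. \<forall>j<n. i \<noteq> j \<longrightarrow> {x i<..<y i} \<inter> {x j<..<y j} = {}) \<longrightarrow>
        (\<Sum>i<n. y i - x i) < \<delta> \<longrightarrow> (\<Sum>i<n. \<bar>g (y i) - g (x i)\<bar>) < \<epsilon>"
    using assms(1)[unfolded abs_continuous_on_def, THEN spec, THEN mp, OF \<open>\<epsilon> > 0\<close>] by (elim exE conjE)
  have "\<forall>i<n. x i \<le> y i \<and> {x i..y i} \<subseteq> S" if "\<forall>i<n. x i \<le> y i \<and> {x i..y i} \<subseteq> R"
    for n :: nat and x y :: "nat \<Rightarrow> real"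
    using that assms(2) by blast
  with \<open>\<delta> > 0\<close> show "\<exists>\<delta>>0. \<forall>(n::nat) (x::nat \<Rightarrow> real) (y::nat \<Rightarrow> real).
        (\<forall>i<n. x i \<le> y i \<and> {x i..y i} \<subseteq> R) \<longrightarrow>
        (\<forall>i<n. \<forall>j<n. i \<noteq> j \<longrightarrow> {x i<..<y i} \<inter> {x j<..<y j} = {}) \<longrightarrow>
        (\<Sum>i<n. y i - x i) < \<delta> \<longrightarrow>
        (\<Sum>i<n. \<bar>g (y i) - g (x i)\<bar>) < \<epsilon>"
    by (intro exI[of _ \<delta>] conjI allI impI) (assumption, rule \<delta>[THEN spec, THEN spec, THEN spec, THEN mp, THEN mp, THEN mp], blast+)
qed

text \<open>The gauge integral works with tagged sets of intervals, absolute continuity with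
  numbered ones; this translates between them.\<close>

lemma abs_continuous_on_tagged_partial_division:
  assumes ac: "abs_continuous_on {a..b} g" and "\<epsilon> > 0"
  obtains \<delta> where "\<delta> > 0"
    "\<And>p. p tagged_partial_division_of {a..b} \<Longrightarrow> (\<Sum>(x,K)\<in>p. content K) < \<delta> \<Longrightarrow>
       (\<Sum>(x,K)\<in>p. \<bar>g (Sup K) - g (Inf K)\<bar>) < \<epsilon>"
proof -
  obtain \<delta> where "\<delta> > 0"
    and \<delta>: "\<forall>(n::nat) x y. (\<forall>i<n. x i \<le> y i \<and> {x i..y i} \<subseteq> {a..b}) \<longrightarrow>
        (\<forall>i<n. \<forall>j<n. i \<noteq> j \<longrightarrow> {x i<..<y i} \<inter> {x j<..<y j} = {}) \<longrightarrow>
        (\<Sum>i<n. y i - x i) < \<delta> \<longrightarrow> (\<Sum>i<n. \<bar>g (y i) - g (x i)\<bar>) < \<epsilon>"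
    using ac[unfolded abs_continuous_on_def, THEN spec, THEN mp, OF \<open>\<epsilon> > 0\<close>] by (elim exE conjE)
  show thesis
  proof (rule that[OF \<open>\<delta> > 0\<close>])
    fix p assume p: "p tagged_partial_division_of {a..b}" and small: "(\<Sum>(x,K)\<in>p. content K) < \<delta>"
    have "finite p"
      using p by (rule tagged_partial_division_ofD)
    then obtain e where e: "bij_betw e {..<card p} p"
      using ex_bij_betw_nat_finite atLeast0LessThan by metis
    have K: "\<exists>c d. c \<le> d \<and> K = {c..d} \<and> K \<subseteq> {a..b}" if xK: "(x, K) \<in> p" for x K
    proof -
      obtain c d where "K = cbox c d"
        using tagged_partial_division_ofD(4)[OF p xK] by auto
      with tagged_partial_division_ofD(2,3)[OF p xK] show ?thesis
        by (intro exI[of _ c] exI[of _ d]) auto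
    qed
    have sum_e: "(\<Sum>(x,K)\<in>p. f K) = (\<Sum>i<card p. f (snd (e i)))" for f :: "real set \<Rightarrow> real"
      using sum.reindex_bij_betw[OF e, of "\<lambda>(x,K). f K"] by (simp add: case_prod_unfold)
    have ep: "e i \<in> p" if "i < card p" for i
      using e that by (auto simp: bij_betw_def)
    have eK: "\<exists>c d. c \<le> d \<and> snd (e i) = {c..d} \<and> {c..d} \<subseteq> {a..b}" if "i < card p" for i
      using K[of "fst (e i)" "snd (e i)"] ep[OF that] by auto
    have "(\<Sum>i<card p. \<bar>g (Sup (snd (e i))) - g (Inf (snd (e i)))\<bar>) < \<epsilon>"
    proof (rule \<delta>[THEN spec, THEN spec, THEN spec, THEN mp, THEN mp, THEN mp])
      show "\<forall>i<card p. Inf (snd (e i)) \<le> Sup (snd (e i)) \<and> {Inf (snd (e i))..Sup (snd (e i))} \<subseteq> {a..b}"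
        using eK by fastforce
      show "\<forall>i<card p. \<forall>j<card p. i \<noteq> j \<longrightarrow>
          {Inf (snd (e i))<..<Sup (snd (e i))} \<inter> {Inf (snd (e j))<..<Sup (snd (e j))} = {}"
      proof (intro allI impI)
        fix i j assume ij: "i < card p" "j < card p" "i \<noteq> j"
        then have "e i \<noteq> e j"
          using e by (auto simp: bij_betw_def inj_on_def)
        then have "interior (snd (e i)) \<inter> interior (snd (e j)) = {}"
          using tagged_partial_division_ofD(5)[OF p, of "fst (e i)" "snd (e i)" "fst (e j)" "snd (e j)"]
            ep ij by simp
        then show "{Inf (snd (e i))<..<Sup (snd (e i))} \<inter> {Inf (snd (e j))<..<Sup (snd (e j))} = {}"
          using eK[OF ij(1)] eK[OF ij(2)] by auto
      qed
      have "content (snd (e i)) = Sup (snd (e i)) - Inf (snd (e i))" if "i < card p" for i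
        using eK[OF that] by auto
      then show "(\<Sum>i<card p. Sup (snd (e i)) - Inf (snd (e i))) < \<delta>"
        using small sum_e[of content] by simp
    qed
    then show "(\<Sum>(x,K)\<in>p. \<bar>g (Sup K) - g (Inf K)\<bar>) < \<epsilon>"
      using sum_e[of "\<lambda>K. \<bar>g (Sup K) - g (Inf K)\<bar>"] by simp
  qed
qed

text \<open>A direct gauge argument. Where the tag is a point of differentiability, the increment of
  \<open>g\<close> is close to \<open>h\<close> times the length. The intervals tagged in the
  exceptional null set can be forced to have small total length, and absolute continuity then makes
  the increments over them small.\<close>

theorem fundamental_theorem_of_calculus_abs_continuous:
  assumes "a \<le> b" and ac: "abs_continuous_on {a..b} g"
    and deriv: "AE t in lebesgue. t \<in> {a..b} \<longrightarrow> (g has_real_derivative h t) (at t within {a..b})"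
  shows "(h has_integral g b - g a) {a..b}"
proof -
  obtain N where N: "negligible N"
    and d: "\<And>t. t \<in> {a..b} - N \<Longrightarrow> (g has_real_derivative h t) (at t within {a..b})"
    using deriv unfolding eventually_ae_filter negligible_iff_null_sets by auto
  define h' where "h' t = (if t \<in> N then 0 else h t)" for t
  have "(h' has_integral g b - g a) {a..b}"
    unfolding has_integral_real
  proof (intro allI impI)
    fix e :: real assume "e > 0"
    define e' where "e' = e / (2 * (b - a + 1))"
    have "e' > 0" and e': "e' * (b - a) < e / 2"
      using \<open>e > 0\<close> \<open>a \<le> b\<close> by (auto simp: e'_def field_simps)
    obtain \<delta> where "\<delta> > 0" and \<delta>:
      "\<And>p. p tagged_partial_division_of {a..b} \<Longrightarrow> (\<Sum>(x,K)\<in>p. content K) < \<delta> \<Longrightarrow>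
         (\<Sum>(x,K)\<in>p. \<bar>g (Sup K) - g (Inf K)\<bar>) < e / 2"
      using abs_continuous_on_tagged_partial_division[OF ac, of "e/2"] \<open>e > 0\<close> by auto
    \<comment> \<open>A gauge for this integral is what controls the total length of the intervals
      tagged in \<open>N\<close>.\<close>
    have "(indicat_real N has_integral 0) {a..b}"
      using N[unfolded negligible_def, rule_format, of a b] by simp
    then obtain \<gamma>1 where "gauge \<gamma>1"
      and \<gamma>1: "\<And>p. p tagged_division_of {a..b} \<Longrightarrow> \<gamma>1 fine p \<Longrightarrow>
         norm ((\<Sum>(x,k)\<in>p. content k *\<^sub>R indicat_real N x) - 0) < \<delta>"
      using \<open>\<delta> > 0\<close> unfolding has_integral_real by auto
    have "\<exists>r>0. \<forall>y\<in>{a..b}. \<bar>y - t\<bar> < r \<longrightarrow> \<bar>g y - g t - h t * (y - t)\<bar> \<le> e' * \<bar>y - t\<bar>"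
      if "t \<in> {a..b} - N" for t
      using d[OF that] \<open>e' > 0\<close>
      unfolding has_field_derivative_def has_derivative_within_alt by auto
    then obtain r where r: "\<And>t. t \<in> {a..b} - N \<Longrightarrow> r t > 0"
      "\<And>t y. t \<in> {a..b} - N \<Longrightarrow> y \<in> {a..b} \<Longrightarrow> \<bar>y - t\<bar> < r t \<Longrightarrow>
         \<bar>g y - g t - h t * (y - t)\<bar> \<le> e' * \<bar>y - t\<bar>"
      by metis
    define \<gamma>2 where "\<gamma>2 t = ball t (if t \<in> {a..b} - N then r t else 1)" for t
    have "gauge \<gamma>2"
      using r(1) by (auto simp: gauge_def \<gamma>2_def)
    show "\<exists>\<gamma>. gauge \<gamma> \<and> (\<forall>\<D>. \<D> tagged_division_of {a..b} \<and> \<gamma> fine \<D> \<longrightarrow>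
        norm ((\<Sum>(x,k)\<in>\<D>. content k *\<^sub>R h' x) - (g b - g a)) < e)"
    proof (intro exI conjI allI impI)
      show "gauge (\<lambda>x. \<gamma>1 x \<inter> \<gamma>2 x)"
        by (rule gauge_Int) fact+
      fix p assume "p tagged_division_of {a..b} \<and> (\<lambda>x. \<gamma>1 x \<inter> \<gamma>2 x) fine p"
      then have p: "p tagged_division_of {a..b}" and fine1: "\<gamma>1 fine p" and fine2: "\<gamma>2 fine p"
        by (auto simp: fine_Int)
      have "finite p"
        using p by (rule tagged_division_ofD)
      define pN where "pN = {(x,K) \<in> p. x \<in> N}"
      have pN: "pN \<subseteq> p"
        by (auto simp: pN_def)
      have "(\<Sum>(x,K)\<in>pN. content K) = (\<Sum>(x,K)\<in>p. content K *\<^sub>R indicat_real N x)"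
        using \<open>finite p\<close> unfolding pN_def
        by (intro sum.mono_neutral_cong_left) (auto simp: indicator_def)
      then have smallN: "(\<Sum>(x,K)\<in>pN. \<bar>g (Sup K) - g (Inf K)\<bar>) < e / 2"
        using \<gamma>1[OF p fine1]
        by (intro \<delta> tagged_partial_division_subset[OF _ pN]) (use p in \<open>auto simp: tagged_division_of_def\<close>)
      have good: "\<bar>content K * h' x - (g (Sup K) - g (Inf K))\<bar> \<le> e' * content K"
        if xK: "(x, K) \<in> p - pN" for x K
      proof -
        have "x \<in> K" "K \<subseteq> {a..b}"
          using tagged_division_ofD(2,3)[OF p, of x K] xK by auto
        moreover obtain c d where K: "K = {c..d}"
          using tagged_division_ofD(4)[OF p, of x K] xK by auto
        ultimately have cd: "c \<le> x" "x \<le> d" "c \<in> {a..b}" "d \<in> {a..b}" "x \<in> {a..b}"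
          by auto
        have xN: "x \<notin> N"
          using xK by (auto simp: pN_def)
        have "K \<subseteq> ball x (r x)"
          using fine2 xK cd xN unfolding fine_def \<gamma>2_def by fastforce
        then have "\<bar>c - x\<bar> < r x" "\<bar>d - x\<bar> < r x"
          using cd subsetD[of K "ball x (r x)" c] subsetD[of K "ball x (r x)" d]
          by (auto simp: K dist_real_def abs_minus_commute)
        then have "\<bar>g c - g x - h x * (c - x)\<bar> \<le> e' * \<bar>c - x\<bar>" "\<bar>g d - g x - h x * (d - x)\<bar> \<le> e' * \<bar>d - x\<bar>"
          using r(2)[of x c] r(2)[of x d] cd xN by auto
        then show ?thesis
          using cd xN by (simp add: K h'_def abs_if algebra_simps split: if_splits)
      qed
      have "(\<Sum>(x,K)\<in>p. content K *\<^sub>R h' x) - (g b - g a)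
          = (\<Sum>(x,K)\<in>p. content K * h' x - (g (Sup K) - g (Inf K)))"
        using additive_tagged_division_1[OF \<open>a \<le> b\<close> p, of g]
        by (simp add: case_prod_unfold sum_subtractf)
      also have "\<dots> = (\<Sum>(x,K)\<in>p - pN. content K * h' x - (g (Sup K) - g (Inf K)))
          + (\<Sum>(x,K)\<in>pN. content K * h' x - (g (Sup K) - g (Inf K)))"
        by (rule sum.subset_diff[OF pN \<open>finite p\<close>])
      also have "\<bar>\<dots>\<bar> \<le> (\<Sum>(x,K)\<in>p - pN. e' * content K) + (\<Sum>(x,K)\<in>pN. \<bar>g (Sup K) - g (Inf K)\<bar>)"
      proof (rule order_trans[OF abs_triangle_ineq add_mono])
        show "\<bar>\<Sum>(x,K)\<in>p - pN. content K * h' x - (g (Sup K) - g (Inf K))\<bar> \<le> (\<Sum>(x,K)\<in>p - pN. e' * content K)"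
          by (rule order_trans[OF sum_abs sum_mono]) (use good in auto)
        show "\<bar>\<Sum>(x,K)\<in>pN. content K * h' x - (g (Sup K) - g (Inf K))\<bar> \<le> (\<Sum>(x,K)\<in>pN. \<bar>g (Sup K) - g (Inf K)\<bar>)"
          by (rule order_trans[OF sum_abs sum_mono]) (auto simp: pN_def h'_def)
      qed
      also have "(\<Sum>(x,K)\<in>p - pN. e' * content K) \<le> (\<Sum>(x,K)\<in>p. e' * content K)"
        using \<open>finite p\<close> \<open>e' > 0\<close> by (intro sum_mono2) auto
      also have "\<dots> = e' * (b - a)"
        using additive_content_tagged_division[of p a b] p \<open>a \<le> b\<close>
        by (simp add: case_prod_unfold flip: sum_distrib_left)
      finally show "norm ((\<Sum>(x,k)\<in>p. content k *\<^sub>R h' x) - (g b - g a)) < e"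
        using smallN e' by simp
    qed
  qed
  then show ?thesis
    by (rule has_integral_spike[OF N, rotated]) (auto simp: h'_def)
qed

text \<open>Averages over intervals to the right of a point come from
  \<open>integrable_ccontinuous_explicit\<close>, those to the left from the same result for the
  reflected function, whose exceptional set is reflected back.\<close>

lemma AE_has_derivative_integral:
  fixes h :: "real \<Rightarrow> real"
  assumes h: "h integrable_on {a..b}"
  shows "AE t in lebesgue. t \<in> {a..b} \<longrightarrow>
    ((\<lambda>x. integral {a..x} h) has_real_derivative h t) (at t within {a..b})"
proof -
  define k where "k x = (if x \<in> {a..b} then h x else 0)" for x
  have int_k: "k integrable_on {c..d}" for c d
  proof (rule integrable_on_subinterval)
    show "k integrable_on UNIV"
      unfolding k_def using h by (simp only: integrable_restrict_UNIV)
  qed simp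
  have int_k': "(\<lambda>x. k (- x)) integrable_on {c..d}" for c d
    using int_k[of "-d" "-c"] Henstock_Kurzweil_Integration.integrable_reflect_real[where f = k and a = "-d" and b = "-c"] by simp
  obtain N1 where "negligible N1" and N1: "\<And>x e. x \<notin> N1 \<Longrightarrow> 0 < e \<Longrightarrow>
      \<exists>d>0. \<forall>s. 0 < s \<and> s < d \<longrightarrow> norm (integral (cbox x (x + s *\<^sub>R One)) k /\<^sub>R s ^ DIM(real) - k x) < e"
    using integrable_ccontinuous_explicit[of k] int_k by auto
  obtain N2 where "negligible N2" and N2: "\<And>x e. x \<notin> N2 \<Longrightarrow> 0 < e \<Longrightarrow>
      \<exists>d>0. \<forall>s. 0 < s \<and> s < d \<longrightarrow> norm (integral (cbox x (x + s *\<^sub>R One)) (\<lambda>x. k (-x)) /\<^sub>R s ^ DIM(real) - k (-x)) < e"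
    using integrable_ccontinuous_explicit[of "\<lambda>x. k (-x)"] int_k' by auto
  have "negligible (uminus ` N2)"
    using negligible_differentiable_image_negligible[OF _ \<open>negligible N2\<close>, of uminus] by (simp add: differentiable_on_minus)
  with \<open>negligible N1\<close> have "negligible (N1 \<union> uminus ` N2)"
    by simp
  then have "AE t in lebesgue. t \<notin> N1 \<union> uminus ` N2"
    unfolding negligible_iff_null_sets by (rule AE_not_in)
  then show ?thesis
  proof (rule AE_mp, intro AE_I2 impI)
    fix t assume tN: "t \<notin> N1 \<union> uminus ` N2" and t: "t \<in> {a..b}"
    have diff: "integral {a..y} h - integral {a..x} h = integral {x..y} k" if "a \<le> x" "x \<le> y" "y \<le> b" for x y
    proof -
      have "integral {x..y} k = integral {x..y} h"
        by (rule integral_cong) (use that in \<open>auto simp: k_def\<close>)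
      moreover have "integral {a..x} h + integral {x..y} h = integral {a..y} h"
        by (rule Henstock_Kurzweil_Integration.integral_combine)
          (use that h integrable_on_subinterval[OF h, of a y] in auto)
      ultimately show ?thesis
        by simp
    qed
    show "((\<lambda>x. integral {a..x} h) has_real_derivative h t) (at t within {a..b})"
      unfolding has_field_derivative_iff Lim_within
    proof (intro allI impI)
      fix e :: real assume "e > 0"
      obtain d1 where "d1 > 0" and d1: "\<And>s. 0 < s \<Longrightarrow> s < d1 \<Longrightarrow> \<bar>integral {t..t + s} k / s - k t\<bar> < e"
        using N1[of t e] tN \<open>e > 0\<close> by (auto simp: divide_inverse mult.commute)
      have "- t \<notin> N2"
        using tN by force
      then obtain d2 where "d2 > 0" and d2: "\<And>s. 0 < s \<Longrightarrow> s < d2 \<Longrightarrow> \<bar>integral {-t..-t + s} (\<lambda>x. k (-x)) / s - k t\<bar> < e"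
        using N2[of "-t" e] \<open>e > 0\<close> by (auto simp: divide_inverse mult.commute)
      have "dist ((integral {a..x} h - integral {a..t} h) / (x - t)) (h t) < e"
        if x: "x \<in> {a..b}" "0 < dist x t" "dist x t < min d1 d2" for x
      proof (cases "x > t")
        case True
        then show ?thesis
          using d1[of "x - t"] diff[of t x] x t by (simp add: dist_real_def k_def)
      next
        case False
        have "integral {-t..-x} (\<lambda>x. k (-x)) = integral {x..t} k"
          using Henstock_Kurzweil_Integration.integral_reflect_real[where f = k and a = x and b = t] by simp
        moreover have "(integral {a..x} h - integral {a..t} h) / (x - t) = integral {x..t} k / (t - x)"
        proof -
          have "integral {a..t} h - integral {a..x} h = integral {x..t} k"
            using False x t by (intro diff) auto
          then show ?thesis
            using minus_divide_divide[of "integral {a..t} h - integral {a..x} h" "t - x"]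
            unfolding minus_diff_eq by simp
        qed
        ultimately show ?thesis
          using False d2[of "t - x"] x t by (simp add: dist_real_def k_def)
      qed
      then show "\<exists>d>0. \<forall>x\<in>{a..b}. 0 < dist x t \<and> dist x t < d \<longrightarrow>
          dist ((integral {a..x} h - integral {a..t} h) / (x - t)) (h t) < e"
        using \<open>d1 > 0\<close> \<open>d2 > 0\<close> by (intro exI[of _ "min d1 d2"]) auto
    qed
  qed
qed

lemma antiderivative_UNIV:
  fixes f :: "real \<Rightarrow> real"
  assumes "continuous_on UNIV f"
  obtains F where "\<And>u. (F has_real_derivative f u) (at u)"
proof -
  have "\<exists>F. \<forall>x::real. -\<infinity> < ereal x \<longrightarrow> ereal x < \<infinity> \<longrightarrow> (F has_vector_derivative f x) (at x)"
    by (rule einterval_antiderivative) (use assms in \<open>auto simp: continuous_on_eq_continuous_at\<close>)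
  then show thesis
    using that by (auto simp: has_real_derivative_iff_has_vector_derivative)
qed

lemma deriv_within_nonneg_imp_le:
  fixes g :: "real \<Rightarrow> real"
  assumes d: "\<And>t. t \<in> {a..b} \<Longrightarrow> (g has_real_derivative g' t) (at t within {a..b})"
    and nonneg: "\<And>t. t \<in> {a..b} \<Longrightarrow> g' t \<ge> 0" and st: "a \<le> s" "s \<le> t" "t \<le> b"
  shows "g s \<le> g t"
proof (rule DERIV_nonneg_imp_increasing_open[OF \<open>s \<le> t\<close>])
  fix x assume "s < x" "x < t"
  then show "\<exists>y. (g has_real_derivative y) (at x) \<and> 0 \<le> y"
    using d[of x] nonneg[of x] st by (auto simp: at_within_Icc_at)
next
  show "continuous_on {s..t} g"
    by (rule continuous_on_subset[OF DERIV_continuous_on[OF d]]) (use st in auto)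
qed

lemma lipschitz_imp_abs_continuous_on:
  assumes lip: "\<And>s t. s \<in> S \<Longrightarrow> t \<in> S \<Longrightarrow> \<bar>g t - g s\<bar> \<le> L * \<bar>t - s\<bar>"
  shows "abs_continuous_on S g"
  unfolding abs_continuous_on_def
proof (intro allI impI)
  fix \<epsilon> :: real assume "\<epsilon> > 0"
  show "\<exists>\<delta>>0. \<forall>(n::nat) (x::nat \<Rightarrow> real) (y::nat \<Rightarrow> real).
        (\<forall>i<n. x i \<le> y i \<and> {x i..y i} \<subseteq> S) \<longrightarrow>
        (\<forall>i<n. \<forall>j<n. i \<noteq> j \<longrightarrow> {x i<..<y i} \<inter> {x j<..<y j} = {}) \<longrightarrow>
        (\<Sum>i<n. y i - x i) < \<delta> \<longrightarrow> (\<Sum>i<n. \<bar>g (y i) - g (x i)\<bar>) < \<epsilon>"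
  proof (intro exI conjI allI impI)
    show "\<epsilon> / (\<bar>L\<bar> + 1) > 0"
      using \<open>\<epsilon> > 0\<close> by simp
    fix n :: nat and x y :: "nat \<Rightarrow> real"
    assume xy: "\<forall>i<n. x i \<le> y i \<and> {x i..y i} \<subseteq> S" and small: "(\<Sum>i<n. y i - x i) < \<epsilon> / (\<bar>L\<bar> + 1)"
    have "(\<Sum>i<n. \<bar>g (y i) - g (x i)\<bar>) \<le> (\<Sum>i<n. (\<bar>L\<bar> + 1) * (y i - x i))"
    proof (rule sum_mono)
      fix i assume "i \<in> {..<n}"
      then have "x i \<le> y i" "{x i..y i} \<subseteq> S"
        using xy by auto
      then have i: "x i \<le> y i" "x i \<in> S" "y i \<in> S"
        by auto
      have "\<bar>g (y i) - g (x i)\<bar> \<le> L * (y i - x i)"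
        using lip[OF i(2,3)] i(1) by simp
      also have "\<dots> \<le> (\<bar>L\<bar> + 1) * (y i - x i)"
        using i(1) by (intro mult_right_mono) auto
      finally show "\<bar>g (y i) - g (x i)\<bar> \<le> (\<bar>L\<bar> + 1) * (y i - x i)" .
    qed
    also have "\<dots> = (\<bar>L\<bar> + 1) * (\<Sum>i<n. y i - x i)"
      by (rule sum_distrib_left[symmetric])
    also have "\<dots> < \<epsilon>"
      using small by (simp only: pos_less_divide_eq[of "\<bar>L\<bar> + 1"] mult.commute)
    finally show "(\<Sum>i<n. \<bar>g (y i) - g (x i)\<bar>) < \<epsilon>" .
  qed
qed

lemma integral_lipschitz:
  fixes h :: "real \<Rightarrow> real"
  assumes h: "h integrable_on {0..T}" and K: "\<And>x. x \<in> {0..T} \<Longrightarrow> \<bar>h x\<bar> \<le> K"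
    and st: "s \<in> {0..T}" "t \<in> {0..T}"
  shows "\<bar>integral {0..t} h - integral {0..s} h\<bar> \<le> K * \<bar>t - s\<bar>"
proof -
  have *: "\<bar>integral {0..t} h - integral {0..s} h\<bar> \<le> K * (t - s)"
    if "s \<in> {0..T}" "t \<in> {0..T}" "s \<le> t" for s t
  proof -
    have sub: "h integrable_on {s..t}" "h integrable_on {0..t}"
      using that integrable_on_subinterval[OF h] by auto
    have "integral {0..s} h + integral {s..t} h = integral {0..t} h"
      by (rule Henstock_Kurzweil_Integration.integral_combine) (use that sub in auto)
    moreover have "norm (integral {s..t} h) \<le> integral {s..t} (\<lambda>x. K)"
      by (rule integral_norm_bound_integral) (use sub K that in auto)
    ultimately show ?thesis
      using that by (simp add: mult.commute)
  qed
  show ?thesis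
    using *[OF st] *[OF st(2,1)] by (cases "s \<le> t") (auto simp: abs_minus_commute)
qed

section \<open>Uniform limits and compact sets of functions\<close>

text \<open>Functions on [0,T] are represented by their extensions that are constant on either side
  of the interval. They thereby become elements of the normed space of bounded continuous functions
  on the line, to which Schauder's theorem applies.\<close>

definition clamped_lipschitz :: "real \<Rightarrow> real \<Rightarrow> real \<Rightarrow> (real \<Rightarrow>\<^sub>C real) set" where
  "clamped_lipschitz T M L = {w :: real \<Rightarrow>\<^sub>C real. (\<forall>t. \<bar>w t\<bar> \<le> M) \<and> (\<forall>s t. \<bar>w s - w t\<bar> \<le> L * \<bar>s - t\<bar>) \<and>
     (\<forall>t. w t = w (max 0 (min T t)))}"

lemma convex_clamped_lipschitz: "convex (clamped_lipschitz T M L)"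
proof (rule convexI)
  fix x y :: "real \<Rightarrow>\<^sub>C real" and u v :: real
  assume x: "x \<in> clamped_lipschitz T M L" and y: "y \<in> clamped_lipschitz T M L"
    and uv: "0 \<le> u" "0 \<le> v" "u + v = 1"
  have comb: "\<bar>u * p + v * q\<bar> \<le> R" if "\<bar>p\<bar> \<le> R" "\<bar>q\<bar> \<le> R" for p q R
    using that uv convex_bound_le[of p R q u v] convex_bound_le[of "-p" R "-q" u v] by (auto simp: abs_le_iff)
  have "\<bar>u * x t + v * y t\<bar> \<le> M" for t
    using x y by (intro comb) (auto simp: clamped_lipschitz_def)
  moreover have "\<bar>(u * x s + v * y s) - (u * x t + v * y t)\<bar> \<le> L * \<bar>s - t\<bar>" for s t
    using comb[of "x s - x t" "L * \<bar>s - t\<bar>" "y s - y t"] x y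
    by (simp add: clamped_lipschitz_def algebra_simps)
  moreover have "u * x t + v * y t = u * x (max 0 (min T t)) + v * y (max 0 (min T t))" for t
    using x y by (simp add: clamped_lipschitz_def)
  ultimately show "u *\<^sub>R x + v *\<^sub>R y \<in> clamped_lipschitz T M L"
    by (simp add: clamped_lipschitz_def plus_bcontfun.rep_eq scaleR_bcontfun.rep_eq)
qed

lemma compact_clamped_lipschitz:
  assumes "T \<ge> 0"
  shows "compact (clamped_lipschitz T M L)"
  unfolding compact_def
proof (intro allI impI)
  fix w :: "nat \<Rightarrow> (real \<Rightarrow>\<^sub>C real)"
  assume w: "\<forall>n. w n \<in> clamped_lipschitz T M L"
  define cl where "cl t = max 0 (min T t)" for t
  have cl: "cl t \<in> {0..T}" for t
    using \<open>T \<ge> 0\<close> by (auto simp: cl_def)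
  have wM: "\<bar>w n t\<bar> \<le> M" and wL: "\<bar>w n s - w n t\<bar> \<le> L * \<bar>s - t\<bar>" and wcl: "w n t = w n (cl t)" for n s t
    using w by (auto simp: clamped_lipschitz_def cl_def)
  obtain g k where g: "continuous_on {0..T} g" and k: "strict_mono (k :: nat \<Rightarrow> nat)"
    and conv: "\<And>e. 0 < e \<Longrightarrow> \<exists>N. \<forall>n x. n \<ge> N \<and> x \<in> {0..T} \<longrightarrow> norm (w (k n) x - g x) < e"
  proof (rule Arzela_Ascoli[of "{0..T}" "\<lambda>n. apply_bcontfun (w n)" M])
    fix x e :: real assume "0 < e"
    show "\<exists>d>0. \<forall>n y. y \<in> {0..T} \<and> norm (x - y) < d \<longrightarrow> norm (w n x - w n y) < e"
    proof (intro exI conjI allI impI)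
      show "e / (\<bar>L\<bar> + 1) > 0"
        using \<open>0 < e\<close> by simp
      fix n y assume "y \<in> {0..T} \<and> norm (x - y) < e / (\<bar>L\<bar> + 1)"
      then have "(\<bar>L\<bar> + 1) * \<bar>x - y\<bar> < e"
        by (simp add: field_simps)
      moreover have "L * \<bar>x - y\<bar> \<le> (\<bar>L\<bar> + 1) * \<bar>x - y\<bar>"
        by (intro mult_right_mono) auto
      ultimately show "norm (w n x - w n y) < e"
        using wL[of n x y] by simp
    qed
  qed (use wM in auto)
  have gcl: "(\<lambda>t. g (cl t)) \<in> bcontfun"
  proof -
    have "continuous_on UNIV (\<lambda>t. g (cl t))"
      by (rule continuous_on_compose2[OF g]) (use cl in \<open>auto simp: cl_def intro!: continuous_intros\<close>)
    moreover have "bounded (range (\<lambda>t. g (cl t)))"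
      by (rule bounded_subset[OF compact_imp_bounded[OF compact_continuous_image[OF g]]]) (use cl in auto)
    ultimately show ?thesis
      by (simp add: bcontfun_def)
  qed
  define l where "l = Bcontfun (\<lambda>t. g (cl t))"
  have l: "l t = g (cl t)" for t
    by (simp add: l_def Bcontfun_inverse[OF gcl])
  have lim: "(\<lambda>n. w (k n)) \<longlonglongrightarrow> l"
  proof (rule uniform_limit_tendsto_bcontfun, rule uniform_limitI)
    fix e :: real assume "e > 0"
    then obtain N where N: "\<And>n x. n \<ge> N \<Longrightarrow> x \<in> {0..T} \<Longrightarrow> norm (w (k n) x - g x) < e"
      using conv by blast
    have "dist (w (k n) t) (l t) < e" if "n \<ge> N" for n t
      using N[OF that cl, of t] wcl[of "k n" t] by (simp add: dist_norm l)
    then show "\<forall>\<^sub>F n in sequentially. \<forall>x\<in>UNIV. dist (w (k n) x) (l x) < e"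
      unfolding eventually_sequentially by blast
  qed
  have lim_t: "(\<lambda>n. w (k n) t) \<longlonglongrightarrow> l t" for t
    using tendsto_uniform_limitI[OF tendsto_bcontfun_uniform_limit[OF lim]] by simp
  have "l \<in> clamped_lipschitz T M L"
    unfolding clamped_lipschitz_def
  proof (intro CollectI conjI allI)
    show "\<bar>l t\<bar> \<le> M" for t
      by (rule LIMSEQ_le_const2[OF tendsto_rabs[OF lim_t]]) (use wM in auto)
    show "\<bar>l s - l t\<bar> \<le> L * \<bar>s - t\<bar>" for s t
      by (rule LIMSEQ_le_const2[OF tendsto_rabs[OF tendsto_diff[OF lim_t lim_t]]]) (use wL in auto)
    show "l t = l (max 0 (min T t))" for t
      using \<open>T \<ge> 0\<close> by (simp add: l cl_def)
  qed
  with k lim show "\<exists>l\<in>clamped_lipschitz T M L. \<exists>r. strict_mono r \<and> (w \<circ> r) \<longlonglongrightarrow> l"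
    by (auto simp: o_def)
qed

text \<open>As \<open>l\<close> is bounded, the values \<open>f n x\<close> eventually lie in one
  compact interval, on which \<open>g\<close> is uniformly continuous.\<close>

lemma uniform_limit_compose_continuous:
  fixes g :: "real \<Rightarrow> real"
  assumes g: "continuous_on UNIV g" and "bounded (l ` S)" and lim: "uniform_limit S f l F"
  shows "uniform_limit S (\<lambda>n x. g (f n x)) (\<lambda>x. g (l x)) F"
proof (rule uniform_limitI)
  fix \<epsilon> :: real assume "\<epsilon> > 0"
  obtain R where R: "\<And>x. x \<in> S \<Longrightarrow> \<bar>l x\<bar> \<le> R"
    using \<open>bounded (l ` S)\<close> by (auto simp: bounded_iff)
  have "uniformly_continuous_on {-(R+1)..R+1} g"
    by (rule compact_uniformly_continuous[OF continuous_on_subset[OF g]]) auto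
  then obtain d where "d > 0"
    and d: "\<And>x y. x \<in> {-(R+1)..R+1} \<Longrightarrow> y \<in> {-(R+1)..R+1} \<Longrightarrow> dist y x < d \<Longrightarrow> dist (g y) (g x) < \<epsilon>"
    using \<open>\<epsilon> > 0\<close> unfolding uniformly_continuous_on_def by metis
  have "\<forall>\<^sub>F n in F. \<forall>x\<in>S. dist (f n x) (l x) < min d 1"
    using uniform_limitD[OF lim, of "min d 1"] \<open>d > 0\<close> by simp
  then show "\<forall>\<^sub>F n in F. \<forall>x\<in>S. dist (g (f n x)) (g (l x)) < \<epsilon>"
  proof eventually_elim
    case (elim n)
    show ?case
    proof
      fix x assume "x \<in> S"
      with elim R[of x] show "dist (g (f n x)) (g (l x)) < \<epsilon>"
        by (intro d) (auto simp: dist_real_def)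
    qed
  qed
qed

text \<open>The error is at most the uniform distance times the integral of the weight. The weight
  is \<open>a\<close> when this is applied to \<open>P\<close> and 1 when it is applied to
  \<open>V\<close>.\<close>

lemma uniform_limit_weighted_integral:
  fixes a :: "real \<Rightarrow> real"
  assumes a: "a integrable_on {0..T}" and a0: "\<And>x. x \<in> {0..T} \<Longrightarrow> 0 \<le> a x"
    and g: "\<And>n. (\<lambda>x. a x * g n x) integrable_on {0..T}" and l: "(\<lambda>x. a x * l x) integrable_on {0..T}"
    and lim: "uniform_limit {0..T} g l F"
  shows "uniform_limit {0..T} (\<lambda>n t. integral {0..t} (\<lambda>x. a x * g n x)) (\<lambda>t. integral {0..t} (\<lambda>x. a x * l x)) F"
proof (rule uniform_limitI)
  fix \<epsilon> :: real assume "\<epsilon> > 0"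
  define J where "J = integral {0..T} a"
  have "J \<ge> 0"
    unfolding J_def by (rule integral_nonneg[OF a a0])
  define \<eta> where "\<eta> = \<epsilon> / (J + 1)"
  have "\<eta> > 0" and eta: "\<eta> * J < \<epsilon>"
    using \<open>\<epsilon> > 0\<close> \<open>J \<ge> 0\<close> by (auto simp: \<eta>_def field_simps)
  show "\<forall>\<^sub>F n in F. \<forall>t\<in>{0..T}. dist (integral {0..t} (\<lambda>x. a x * g n x)) (integral {0..t} (\<lambda>x. a x * l x)) < \<epsilon>"
    using uniform_limitD[OF lim \<open>\<eta> > 0\<close>]
  proof eventually_elim
    case (elim n)
    show ?case
    proof
      fix t assume t: "t \<in> {0..T}"
      have sub: "h integrable_on {0..t}" if "h integrable_on {0..T}" for h :: "real \<Rightarrow> real"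
        using integrable_on_subinterval[OF that] t by auto
      have "integral {0..t} (\<lambda>x. a x * g n x) - integral {0..t} (\<lambda>x. a x * l x) =
          integral {0..t} (\<lambda>x. a x * g n x - a x * l x)"
        by (rule integral_diff[symmetric]) (auto intro: sub g l)
      also have "norm \<dots> \<le> integral {0..t} (\<lambda>x. \<eta> * a x)"
      proof (rule integral_norm_bound_integral)
        show "(\<lambda>x. a x * g n x - a x * l x) integrable_on {0..t}"
          by (intro integrable_diff sub g l)
        show "(\<lambda>x. \<eta> * a x) integrable_on {0..t}"
          using sub[OF a] by (rule integrable_on_mult_right)
        fix x assume "x \<in> {0..t}"
        then have x: "x \<in> {0..T}"
          using t by auto
        have "norm (a x * g n x - a x * l x) = a x * \<bar>g n x - l x\<bar>"
          using a0[OF x] by (simp add: abs_mult flip: right_diff_distrib)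
        also have "\<dots> \<le> a x * \<eta>"
          using elim x a0[OF x] by (intro mult_left_mono) (auto simp: dist_real_def less_imp_le)
        finally show "norm (a x * g n x - a x * l x) \<le> \<eta> * a x"
          by (simp add: mult.commute)
      qed
      also have "\<dots> \<le> \<eta> * J"
        unfolding J_def integral_mult_right
        using \<open>\<eta> > 0\<close> a a0 t sub[OF a] by (intro mult_left_mono integral_subset_le) auto
      finally show "dist (integral {0..t} (\<lambda>x. a x * g n x)) (integral {0..t} (\<lambda>x. a x * l x)) < \<epsilon>"
        using eta by (simp add: dist_real_def)
    qed
  qed
qed

text \<open>An infimum moves by no more than the uniform distance of the functions. This makes the
  shift that prescribes the minimum a continuous operation.\<close>

lemma uniform_limit_INF:
  fixes f :: "'i \<Rightarrow> real \<Rightarrow> real"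
  assumes "T \<ge> 0" and lim: "uniform_limit {0..T} f l F"
    and f: "\<And>n. continuous_on {0..T} (f n)" and l: "continuous_on {0..T} l"
  shows "((\<lambda>n. INF x\<in>{0..T}. f n x) \<longlongrightarrow> (INF x\<in>{0..T}. l x)) F"
proof (rule tendstoI)
  fix \<epsilon> :: real assume "\<epsilon> > 0"
  have bdd: "bdd_below (h ` {0..T})" if "continuous_on {0..T} h" for h :: "real \<Rightarrow> real"
    using compact_imp_bounded[OF compact_continuous_image[OF that]] bounded_imp_bdd_below by auto
  have INF_le: "(INF x\<in>{0..T}. h x) \<le> (INF x\<in>{0..T}. k x) + \<epsilon>/2"
    if "\<And>x. x \<in> {0..T} \<Longrightarrow> \<bar>h x - k x\<bar> < \<epsilon>/2" "continuous_on {0..T} h" for h k :: "real \<Rightarrow> real"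
  proof -
    have "(INF x\<in>{0..T}. h x) - \<epsilon>/2 \<le> (INF x\<in>{0..T}. k x)"
    proof (rule cINF_greatest)
      fix x assume x: "x \<in> {0..T}"
      have "(INF x\<in>{0..T}. h x) \<le> h x"
        by (rule cINF_lower[OF bdd[OF that(2)] x])
      with that(1)[OF x] show "(INF x\<in>{0..T}. h x) - \<epsilon>/2 \<le> k x"
        by linarith
    qed (use \<open>T \<ge> 0\<close> in auto)
    then show ?thesis
      by linarith
  qed
  have "\<epsilon> / 2 > 0"
    using \<open>\<epsilon> > 0\<close> by simp
  from uniform_limitD[OF lim this]
  show "\<forall>\<^sub>F n in F. dist (INF x\<in>{0..T}. f n x) (INF x\<in>{0..T}. l x) < \<epsilon>"
  proof eventually_elim
    case (elim n)
    have "(INF x\<in>{0..T}. f n x) \<le> (INF x\<in>{0..T}. l x) + \<epsilon>/2"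
      using elim by (intro INF_le f) (auto simp: dist_real_def)
    moreover have "(INF x\<in>{0..T}. l x) \<le> (INF x\<in>{0..T}. f n x) + \<epsilon>/2"
      using elim by (intro INF_le l) (auto simp: dist_real_def abs_minus_commute)
    ultimately show ?case
      using \<open>\<epsilon> > 0\<close> by (simp add: dist_real_def)
  qed
qed

section \<open>The equation in integral form\<close>

text \<open>The bounds on \<open>a\<close> and \<open>e\<close> are imposed at every point of the
  interval. For essentially bounded coefficients this is achieved at the end by a change on a null
  set.\<close>

locale weighted_lienard =
  fixes T A \<omega> :: real and \<phi> \<psi> f F q a e :: "real \<Rightarrow> real"
  assumes T_pos: "0 < T"
    and phi_mono: "strict_mono \<phi>" and phi0: "\<phi> 0 = 0"
    and phi_psi: "\<And>x. \<phi> (\<psi> x) = x" and psi_phi: "\<And>x. \<psi> (\<phi> x) = x"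
    and psi_cont: "continuous_on UNIV \<psi>"
    and f_cont: "continuous_on UNIV f" and F_deriv: "\<And>u. (F has_real_derivative f u) (at u)"
    and q_cont: "continuous_on UNIV q"
    and q_bot: "(q \<longlongrightarrow> \<omega>) at_bot" and q_top: "(q \<longlongrightarrow> \<omega>) at_top"
    and a_int: "a integrable_on {0..T}" and e_int: "e integrable_on {0..T}"
    and a_bound: "\<And>t. t \<in> {0..T} \<Longrightarrow> 0 \<le> a t \<and> a t \<le> A"
    and e_bound: "\<And>t. t \<in> {0..T} \<Longrightarrow> \<bar>e t\<bar> \<le> A"
    and a_mean: "integral {0..T} a = T" and e_mean: "integral {0..T} e = 0"
begin

section \<open>Elementary bounds and the integral operator\<close>

definition "Q = (SOME Q. \<forall>u. \<bar>q u\<bar> \<le> Q)"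

lemma q_le_Q: "\<bar>q u\<bar> \<le> Q"
proof -
  obtain R1 where R1: "\<And>u. u \<ge> R1 \<Longrightarrow> dist (q u) \<omega> < 1"
    using tendstoD[OF q_top, of 1] by (auto simp: eventually_at_top_linorder)
  obtain R2 where R2: "\<And>u. u \<le> R2 \<Longrightarrow> dist (q u) \<omega> < 1"
    using tendstoD[OF q_bot, of 1] by (auto simp: eventually_at_bot_linorder)
  have "bounded (q ` {R2..R1})"
    by (intro compact_imp_bounded compact_continuous_image continuous_on_subset[OF q_cont]) auto
  then obtain R3 where R3: "\<forall>u\<in>{R2..R1}. \<bar>q u\<bar> \<le> R3"
    by (auto simp: bounded_iff)
  have "\<bar>q u\<bar> \<le> max R3 (\<bar>\<omega>\<bar> + 1)" for u
    using R1[of u] R2[of u] R3[rule_format, of u] by (cases "u \<ge> R1"; cases "u \<le> R2") (auto simp: dist_real_def)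
  then have "\<exists>Q. \<forall>u. \<bar>q u\<bar> \<le> Q"
    by blast
  then have "\<forall>u. \<bar>q u\<bar> \<le> Q"
    unfolding Q_def by (rule someI_ex)
  then show ?thesis
    by blast
qed

lemma a_nonneg: "t \<in> {0..T} \<Longrightarrow> 0 \<le> a t"
  using a_bound by blast

lemma psi_strict_mono: "x < y \<Longrightarrow> \<psi> x < \<psi> y"
  by (metis phi_psi strict_mono_less[OF phi_mono])

lemma psi_mono: "x \<le> y \<Longrightarrow> \<psi> x \<le> \<psi> y"
  using psi_strict_mono[of x y] by (cases "x = y") auto

lemma psi_abs_le:
  assumes "\<bar>x\<bar> \<le> R"
  shows "\<bar>\<psi> x\<bar> \<le> max (\<psi> R) (- \<psi> (- R))"
proof -
  have "\<psi> x \<le> \<psi> R" "\<psi> (- R) \<le> \<psi> x"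
    using assms by (auto intro!: psi_mono)
  then show ?thesis
    by (auto simp: abs_le_iff le_max_iff_disj)
qed

lemma psi0: "\<psi> 0 = 0"
  by (metis phi0 psi_phi)

lemma F_cont: "continuous_on S F"
  using F_deriv by (meson DERIV_continuous continuous_at_imp_continuous_on)

definition E where "E t = integral {0..t} e"
definition sig where "sig w = integral {0..T} (\<lambda>x. a x * q (w x)) / T"
definition P where "P w t = integral {0..t} (\<lambda>x. a x * q (w x))"
text \<open>\<open>c + H G w\<close> is the integrated equation, hence the value of
  \<open>\<phi>\<close> at the derivative. Since \<open>sig w\<close> is the mean of
  \<open>a q(w)\<close>, \<open>H G w\<close> takes equal values at 0 and \<open>T\<close> whenever
  \<open>w\<close> does. \<open>G\<close> will be \<open>F\<close> or a bounded truncation of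
  it.\<close>

definition H where "H G w t = sig w * t - P w t - G (w t) + E t"
definition V where "V G c w t = integral {0..t} (\<lambda>x. \<psi> (c + H G w x))"

lemma E_cont: "continuous_on {0..T} E"
  unfolding E_def using e_int by (rule indefinite_integral_continuous_1)

lemma E_0: "E 0 = 0" and E_T: "E T = 0"
  by (auto simp: E_def e_mean)

lemma weighted_integrable:
  assumes "continuous_on {0..T} g"
  shows "(\<lambda>x. a x * g x) integrable_on {0..T}"
proof -
  have "a absolutely_integrable_on {0..T}"
    by (rule nonnegative_absolutely_integrable_1[OF a_int]) (use a_nonneg in auto)
  moreover have "bounded (g ` {0..T})"
    using compact_continuous_image[OF assms] compact_imp_bounded by blast
  moreover have "g \<in> borel_measurable (lebesgue_on {0..T})"
    by (rule continuous_imp_measurable_on_sets_lebesgue[OF assms]) auto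
  ultimately have "(\<lambda>x. g x * a x) absolutely_integrable_on {0..T}"
    by (intro absolutely_integrable_bounded_measurable_product_real) auto
  then show ?thesis
    by (simp add: absolutely_integrable_on_def mult.commute)
qed

lemma q_comp_cont: "continuous_on S w \<Longrightarrow> continuous_on S (\<lambda>x. q (w x))"
  by (rule continuous_on_compose2[OF q_cont]) auto

lemma aq_integrable: "continuous_on {0..T} w \<Longrightarrow> (\<lambda>x. a x * q (w x)) integrable_on {0..T}"
  by (intro weighted_integrable q_comp_cont)

lemma P_cont: "continuous_on {0..T} w \<Longrightarrow> continuous_on {0..T} (P w)"
  unfolding P_def by (intro indefinite_integral_continuous_1 aq_integrable)

lemma P_T: "P w T = sig w * T" and P_0: "P w 0 = 0"
  using T_pos by (auto simp: P_def sig_def)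

lemma P_bound:
  assumes "continuous_on {0..T} w" "t \<in> {0..T}"
  shows "\<bar>P w t\<bar> \<le> Q * T"
proof -
  have sub: "h integrable_on {0..t}" if "h integrable_on {0..T}" for h :: "real \<Rightarrow> real"
    using integrable_on_subinterval[OF that] assms by auto
  have "norm (P w t) \<le> integral {0..t} (\<lambda>x. Q * a x)"
    unfolding P_def
  proof (rule integral_norm_bound_integral)
    show "(\<lambda>x. Q * a x) integrable_on {0..t}"
      using sub[OF a_int] by (rule integrable_on_mult_right)
    show "norm (a x * q (w x)) \<le> Q * a x" if "x \<in> {0..t}" for x
      using mult_left_mono[OF q_le_Q[of "w x"] a_nonneg[of x]] a_nonneg[of x] that assms(2)
      by (simp add: abs_mult mult.commute)
  qed (intro sub aq_integrable assms)
  also have "\<dots> \<le> Q * integral {0..T} a"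
    unfolding integral_mult_right
    using q_le_Q[of 0] a_nonneg a_int sub[OF a_int] assms(2)
    by (intro mult_left_mono integral_subset_le) auto
  finally show ?thesis
    by (simp add: a_mean)
qed

lemma sig_bound: "continuous_on {0..T} w \<Longrightarrow> \<bar>sig w\<bar> \<le> Q"
  using P_bound[of w T] T_pos by (simp add: P_T abs_mult)

definition bE where "bE = (SOME b. \<forall>t\<in>{0..T}. \<bar>E t\<bar> \<le> b)"

lemma E_bound: "t \<in> {0..T} \<Longrightarrow> \<bar>E t\<bar> \<le> bE"
proof -
  have "bounded (E ` {0..T})"
    using compact_continuous_image[OF E_cont] compact_imp_bounded by blast
  then have "\<exists>b. \<forall>t\<in>{0..T}. \<bar>E t\<bar> \<le> b"
    by (auto simp: bounded_iff)
  then have "\<forall>t\<in>{0..T}. \<bar>E t\<bar> \<le> bE"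
    unfolding bE_def by (rule someI_ex)
  then show "t \<in> {0..T} \<Longrightarrow> \<bar>E t\<bar> \<le> bE"
    by blast
qed

text \<open>Bounds all of \<open>H\<close> except the term \<open>G (w t)\<close>:
  \<open>Q * T\<close> each for \<open>sig w * t\<close> and \<open>P\<close>, and \<open>bE\<close>
  for \<open>E\<close>. It depends neither on \<open>w\<close> nor on \<open>G\<close>.\<close>

definition bH where "bH = 2 * Q * T + bE"

lemma bH_nonneg: "0 \<le> bH"
  using q_le_Q[of 0] E_bound[of 0] T_pos by (simp add: bH_def)

lemma H_G_bound:
  assumes "continuous_on {0..T} w" "t \<in> {0..T}"
  shows "\<bar>H G w t + G (w t)\<bar> \<le> bH"
proof -
  have "\<bar>sig w * t\<bar> \<le> Q * T"
    using sig_bound[OF assms(1)] assms(2) by (auto simp: abs_mult intro!: mult_mono)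
  then show ?thesis
    using P_bound[OF assms] E_bound[OF assms(2)] by (simp add: H_def bH_def)
qed

lemma H_cont:
  assumes G: "continuous_on UNIV G" and w: "continuous_on {0..T} w"
  shows "continuous_on {0..T} (H G w)"
  unfolding H_def
  by (intro continuous_intros P_cont E_cont continuous_on_compose2[OF G w] w) auto

lemma psi_H_cont:
  assumes G: "continuous_on UNIV G" and w: "continuous_on {0..T} w"
  shows "continuous_on {0..T} (\<lambda>x. \<psi> (c + H G w x))"
  by (rule continuous_on_compose2[OF psi_cont]) (auto intro!: continuous_intros H_cont assms)

lemma V_deriv:
  assumes "continuous_on UNIV G" "continuous_on {0..T} w" "t \<in> {0..T}"
  shows "(V G c w has_real_derivative \<psi> (c + H G w t)) (at t within {0..T})"
  unfolding V_def
  using integral_has_real_derivative[OF psi_H_cont[OF assms(1,2)] assms(3)] .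

lemma V_cont:
  assumes "continuous_on UNIV G" "continuous_on {0..T} w"
  shows "continuous_on {0..T} (V G c w)"
  unfolding V_def
  by (intro indefinite_integral_continuous_1 integrable_continuous_real psi_H_cont assms)

lemma V_0: "V G c w 0 = 0"
  by (simp add: V_def)

text \<open>Serves both for the continuity of the fixed point operator and for the limit of a
  maximising sequence of solutions.\<close>

lemma uniform_limits:
  assumes G: "continuous_on UNIV G"
    and w: "\<And>n. continuous_on {0..T} (w n)" and v: "continuous_on {0..T} v"
    and lim: "uniform_limit {0..T} w v sequentially" and c: "c \<longlonglongrightarrow> d"
  shows "(\<lambda>n. sig (w n)) \<longlonglongrightarrow> sig v"
    and "uniform_limit {0..T} (\<lambda>n. V G (c n) (w n)) (V G d v) sequentially"
proof -
  have bdd: "bounded (h ` {0..T})" if "continuous_on {0..T} h" for h :: "real \<Rightarrow> real"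
    using compact_continuous_image[OF that] compact_imp_bounded by blast
  have P: "uniform_limit {0..T} (\<lambda>n. P (w n)) (P v) sequentially"
    unfolding P_def
    by (intro uniform_limit_weighted_integral a_int a_nonneg aq_integrable w v
        uniform_limit_compose_continuous[OF q_cont _ lim] bdd) auto
  have "(\<lambda>n. P (w n) T) \<longlonglongrightarrow> P v T"
    by (rule tendsto_uniform_limitI[OF P]) (use T_pos in auto)
  then have "(\<lambda>n. P (w n) T / T) \<longlonglongrightarrow> P v T / T"
    using T_pos by (intro tendsto_intros) auto
  then show sig: "(\<lambda>n. sig (w n)) \<longlonglongrightarrow> sig v"
    using T_pos by (simp add: P_T)
  have const: "uniform_limit {0..T} (\<lambda>n t. h n) (\<lambda>t. k) sequentially" if "h \<longlonglongrightarrow> k" for h and k :: real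
    using tendstoD[OF that] by (auto simp: uniform_limit_iff elim: eventually_mono)
  have sigt: "uniform_limit {0..T} (\<lambda>n t. sig (w n) * t) (\<lambda>t. sig v * t) sequentially"
    by (intro uniform_lim_mult const sig uniform_limit_const bdd) (auto intro!: continuous_intros)
  have Gw: "uniform_limit {0..T} (\<lambda>n t. G (w n t)) (\<lambda>t. G (v t)) sequentially"
    by (rule uniform_limit_compose_continuous[OF G bdd[OF v] lim])
  have H: "uniform_limit {0..T} (\<lambda>n t. c n + H G (w n) t) (\<lambda>t. d + H G v t) sequentially"
    unfolding H_def
    by (intro uniform_limit_add uniform_limit_minus uniform_limit_const const c sigt P Gw)
  have psi: "uniform_limit {0..T} (\<lambda>n t. \<psi> (c n + H G (w n) t)) (\<lambda>t. \<psi> (d + H G v t)) sequentially"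
    by (rule uniform_limit_compose_continuous[OF psi_cont bdd H]) (intro continuous_intros H_cont G v)
  show "uniform_limit {0..T} (\<lambda>n. V G (c n) (w n)) (V G d v) sequentially"
    using uniform_limit_weighted_integral[of "\<lambda>_. 1" T "\<lambda>n t. \<psi> (c n + H G (w n) t)", OF _ _ _ _ psi]
    unfolding V_def by (simp add: integrable_continuous_real psi_H_cont G w v)
qed

section \<open>The fixed point problem for the triple (r, c, w)\<close>

text \<open>The operator moves \<open>c\<close> against \<open>V G c w T\<close> and
  \<open>r\<close> by \<open>p * (sig w - \<sigma>)\<close>, both clamped to compact intervals, and
  replaces \<open>w\<close> by \<open>V G c w\<close> shifted so that its minimum above
  \<open>\<alpha>\<close> is \<open>r\<close>. The clamp on \<open>c\<close> turns out to be
  inactive. The one on \<open>r\<close> stays in the conclusion, since whether it is active depends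
  on the sign of \<open>sig w - \<sigma>\<close> at the endpoints; with \<open>p = 0\<close> it
  imposes nothing beyond \<open>r \<in> {r0..r1}\<close>.\<close>

lemma lienard_fixpoint:
  assumes G: "continuous_on UNIV G" and bG: "\<And>u. \<bar>G u\<bar> \<le> bG"
    and \<alpha>: "continuous_on {0..T} \<alpha>" and "r0 \<le> r1"
  obtains r c w where "r \<in> {r0..r1}" "continuous_on {0..T} w"
    "r = max r0 (min r1 (r + p * (sig w - \<sigma>)))" "V G c w T = 0"
    "\<forall>t\<in>{0..T}. w t = r + V G c w t - (INF x\<in>{0..T}. V G c w x - \<alpha> x)"
proof -
  define B where "B = bH + bG"
  have "B \<ge> 0"
    using bH_nonneg bG[of 0] by (simp add: B_def)
  have HB: "\<bar>H G w t\<bar> \<le> B" if "continuous_on {0..T} w" "t \<in> {0..T}" for w t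
    using H_G_bound[OF that, of G] bG[of "w t"] by (simp add: B_def)
  \<comment> \<open>\<open>c\<close> and \<open>H G w\<close> both stay within \<open>B\<close>, so
    \<open>L\<close> bounds the slope of \<open>V G c w\<close>.\<close>
  define L where "L = max (\<psi> (2 * B)) (- \<psi> (- (2 * B)))"
  have psiL: "\<bar>\<psi> x\<bar> \<le> L" if "\<bar>x\<bar> \<le> 2 * B" for x
    unfolding L_def by (rule psi_abs_le[OF that])
  have "L \<ge> 0"
    using psiL[of 0] \<open>B \<ge> 0\<close> by auto
  obtain b where "\<forall>t\<in>{0..T}. \<bar>\<alpha> t\<bar> \<le> b"
    using compact_imp_bounded[OF compact_continuous_image[OF \<alpha>]] unfolding bounded_iff by auto
  then have b: "\<bar>\<alpha> t\<bar> \<le> b" if "t \<in> {0..T}" for t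
    using that by blast
  \<comment> \<open>Bounds \<open>r + V - m\<close>: the term \<open>V\<close> contributes
    \<open>L * T\<close> and the infimum \<open>L * T + b\<close>.\<close>
  define M where "M = max \<bar>r0\<bar> \<bar>r1\<bar> + 2 * L * T + b"
  define cl where "cl t = max 0 (min T t)" for t
  have cl: "cl t \<in> {0..T}" for t
    using T_pos by (auto simp: cl_def)
  have cl_id: "cl t = t" if "t \<in> {0..T}" for t
    using that by (auto simp: cl_def)
  define m where "m c w = (INF x\<in>{0..T}. V G c w x - \<alpha> x)" for c w
  define U where "U r c w t = r + V G c w t - m c w" for r c w t
  have V_lip: "\<bar>V G c w s - V G c w t\<bar> \<le> L * \<bar>s - t\<bar>"
    if w: "continuous_on {0..T} w" and c: "\<bar>c\<bar> \<le> B" and st: "s \<in> {0..T}" "t \<in> {0..T}" for c w s t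
  proof -
    have "norm (V G c w s - V G c w t) \<le> L * norm (s - t)"
    proof (rule field_differentiable_bound[OF _ V_deriv[OF G w] _ st])
      show "norm (\<psi> (c + H G w x)) \<le> L" if "x \<in> {0..T}" for x
        using psiL[of "c + H G w x"] HB[OF w that] c by simp
    qed auto
    then show ?thesis
      by simp
  qed
  have V_bound: "\<bar>V G c w t\<bar> \<le> L * T"
    if w: "continuous_on {0..T} w" and c: "\<bar>c\<bar> \<le> B" and t: "t \<in> {0..T}" for c w t
  proof -
    have "\<bar>V G c w t\<bar> \<le> L * t"
      using V_lip[OF w c t, of 0] t T_pos by (simp add: V_0)
    also have "\<dots> \<le> L * T"
      using t \<open>L \<ge> 0\<close> by (intro mult_left_mono) auto
    finally show ?thesis .
  qed
  have m_bound: "\<bar>m c w\<bar> \<le> L * T + b" if w: "continuous_on {0..T} w" and c: "\<bar>c\<bar> \<le> B" for c w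
  proof -
    have *: "\<bar>V G c w t - \<alpha> t\<bar> \<le> L * T + b" if "t \<in> {0..T}" for t
      using V_bound[OF w c that] b[OF that] by linarith
    have lower: "- (L * T + b) \<le> V G c w t - \<alpha> t" if "t \<in> {0..T}" for t
      using *[OF that] by linarith
    have "- (L * T + b) \<le> m c w"
      unfolding m_def by (rule cINF_greatest[OF _ lower]) (use T_pos in auto)
    moreover have "m c w \<le> V G c w 0 - \<alpha> 0"
      unfolding m_def by (rule cINF_lower[OF bdd_belowI2[OF lower]]) (use T_pos in auto)
    ultimately show ?thesis
      using *[of 0] T_pos by auto
  qed
  define S where "S = {r0..r1} \<times> {-B..B} \<times> clamped_lipschitz T M L"
  have U_lip: "\<bar>U r c w (cl s) - U r c w (cl t)\<bar> \<le> L * \<bar>s - t\<bar>"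
    if "continuous_on {0..T} w" "\<bar>c\<bar> \<le> B" for r c w s t
  proof -
    have "\<bar>U r c w (cl s) - U r c w (cl t)\<bar> \<le> L * \<bar>cl s - cl t\<bar>"
      using V_lip[OF that cl cl] by (simp add: U_def)
    also have "\<dots> \<le> L * \<bar>s - t\<bar>"
      using \<open>L \<ge> 0\<close> by (intro mult_left_mono) (auto simp: cl_def)
    finally show ?thesis .
  qed
  have U_bound: "\<bar>U r c w (cl t)\<bar> \<le> M"
    if "continuous_on {0..T} w" "\<bar>c\<bar> \<le> B" "r \<in> {r0..r1}" for r c w t
    using V_bound[OF that(1,2) cl, of t] m_bound[OF that(1,2)] that(3) by (auto simp: U_def M_def)
  have U_bcont: "(\<lambda>t. U r c w (cl t)) \<in> bcontfun"
    if "continuous_on {0..T} w" "\<bar>c\<bar> \<le> B" "r \<in> {r0..r1}" for r c w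
  proof -
    have "continuous_on UNIV (\<lambda>t. U r c w (cl t))"
    proof (rule continuous_on_compose2[of "{0..T}" "U r c w" UNIV cl])
      show "continuous_on {0..T} (U r c w)"
        unfolding U_def by (intro continuous_intros V_cont G that)
    qed (use cl in \<open>auto simp: cl_def intro!: continuous_intros\<close>)
    moreover have "bounded (range (\<lambda>t. U r c w (cl t)))"
      unfolding bounded_iff using U_bound[OF that] by auto
    ultimately show ?thesis
      by (simp add: bcontfun_def)
  qed
  define \<Phi> where "\<Phi> = (\<lambda>(r, c, w :: real \<Rightarrow>\<^sub>C real). (max r0 (min r1 (r + p * (sig w - \<sigma>))),
      max (-B) (min B (c - V G c w T)), Bcontfun (\<lambda>t. U r c w (cl t))))"
  have \<Phi>_in: "\<Phi> x \<in> S" if "x \<in> S" for x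
  proof -
    obtain r c and w :: "real \<Rightarrow>\<^sub>C real" where x: "x = (r, c, w)"
      by (cases x)
    have rc: "r \<in> {r0..r1}" "\<bar>c\<bar> \<le> B"
      using that by (auto simp: S_def x)
    have "Bcontfun (\<lambda>t. U r c w (cl t)) \<in> clamped_lipschitz T M L"
      using U_lip[of w c r] U_bound[of w c r] rc T_pos
      by (simp add: clamped_lipschitz_def Bcontfun_inverse U_bcont flip: cl_def) (simp add: cl_id[OF cl])
    then show ?thesis
      using \<open>B \<ge> 0\<close> \<open>r0 \<le> r1\<close> by (simp add: \<Phi>_def S_def x)
  qed
  have \<Phi>_cont: "continuous_on S \<Phi>"
    unfolding continuous_on_sequentially
  proof (intro allI ballI impI)
    fix X x assume X: "(\<forall>n. X n \<in> S) \<and> X \<longlonglongrightarrow> x" and "x \<in> S"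
    obtain r c and w :: "real \<Rightarrow>\<^sub>C real" where x: "x = (r, c, w)"
      by (cases x)
    define R where "R n = fst (X n)" for n
    define C where "C n = fst (snd (X n))" for n
    define W where "W n = snd (snd (X n))" for n
    have Xn: "X n = (R n, C n, W n)" for n
      by (simp add: R_def C_def W_def)
    have R: "R \<longlonglongrightarrow> r" and C: "C \<longlonglongrightarrow> c" and W: "W \<longlonglongrightarrow> w"
      using tendsto_fst[of X x] tendsto_fst[OF tendsto_snd[of X x]] tendsto_snd[OF tendsto_snd[of X x]] X
      by (auto simp: R_def[abs_def] C_def[abs_def] W_def[abs_def] x)
    have in_S: "R n \<in> {r0..r1}" "\<bar>C n\<bar> \<le> B" for n
      using X Xn[of n] by (auto simp: S_def dest!: spec[of _ n])
    have in_S': "r \<in> {r0..r1}" "\<bar>c\<bar> \<le> B"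
      using \<open>x \<in> S\<close> by (auto simp: S_def x)
    have ul: "uniform_limit {0..T} (\<lambda>n. apply_bcontfun (W n)) w sequentially"
      by (rule uniform_limit_on_subset[OF tendsto_bcontfun_uniform_limit[OF W]]) auto
    note lims = uniform_limits[OF G _ _ ul C, simplified]
    have VT: "(\<lambda>n. V G (C n) (W n) T) \<longlonglongrightarrow> V G c w T"
      by (rule tendsto_uniform_limitI[OF lims(2)]) (use T_pos in auto)
    have m: "(\<lambda>n. m (C n) (W n)) \<longlonglongrightarrow> m c w"
      unfolding m_def using T_pos
      by (intro uniform_limit_INF uniform_limit_minus lims uniform_limit_const continuous_intros V_cont G \<alpha>) auto
    have const: "uniform_limit {0..T} (\<lambda>n t. h n) (\<lambda>t. k) sequentially" if "h \<longlonglongrightarrow> k" for h and k :: real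
      using tendstoD[OF that] by (auto simp: uniform_limit_iff elim: eventually_mono)
    have ulU: "uniform_limit {0..T} (\<lambda>n. U (R n) (C n) (W n)) (U r c w) sequentially"
      unfolding U_def by (intro uniform_limit_add uniform_limit_minus lims const R m)
    have "(\<lambda>n. Bcontfun (\<lambda>t. U (R n) (C n) (W n) (cl t))) \<longlonglongrightarrow> Bcontfun (\<lambda>t. U r c w (cl t))"
    proof (rule uniform_limit_tendsto_bcontfun)
      show "uniform_limit UNIV (\<lambda>n. apply_bcontfun (Bcontfun (\<lambda>t. U (R n) (C n) (W n) (cl t))))
          (Bcontfun (\<lambda>t. U r c w (cl t))) sequentially"
        using uniform_limit_compose'[OF ulU, of cl UNIV] cl
        by (simp add: Bcontfun_inverse[OF U_bcont[OF continuous_on_apply_bcontfun in_S(2,1)]]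
              Bcontfun_inverse[OF U_bcont[OF continuous_on_apply_bcontfun in_S'(2,1)]])
    qed
    then have "(\<lambda>n. (max r0 (min r1 (R n + p * (sig (W n) - \<sigma>))),
      max (-B) (min B (C n - V G (C n) (W n) T)), Bcontfun (\<lambda>t. U (R n) (C n) (W n) (cl t))))
      \<longlonglongrightarrow> (max r0 (min r1 (r + p * (sig w - \<sigma>))),
      max (-B) (min B (c - V G c w T)), Bcontfun (\<lambda>t. U r c w (cl t)))"
      by (intro tendsto_Pair tendsto_max tendsto_min tendsto_intros R C VT lims(1))
    then show "(\<Phi> \<circ> X) \<longlonglongrightarrow> \<Phi> x"
      by (simp add: o_def \<Phi>_def Xn x)
  qed
  have "compact S" "convex S"
    using T_pos unfolding S_def
    by (auto intro!: compact_Times convex_Times compact_clamped_lipschitz convex_clamped_lipschitz)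
  moreover have "const_bcontfun 0 \<in> clamped_lipschitz T M L"
    using \<open>L \<ge> 0\<close> T_pos b[of 0]
    by (auto simp: clamped_lipschitz_def const_bcontfun.rep_eq M_def)
  then have "S \<noteq> {}"
    using \<open>B \<ge> 0\<close> \<open>r0 \<le> r1\<close> by (auto simp: S_def)
  ultimately obtain x where "x \<in> S" "\<Phi> x = x"
    using schauder_fixpoint[OF _ _ _ \<Phi>_cont \<Phi>_in] by blast
  then obtain r c and w :: "real \<Rightarrow>\<^sub>C real" where "(r, c, w) \<in> S" and fp: "\<Phi> (r, c, w) = (r, c, w)"
    by (cases x) auto
  then have rc: "r \<in> {r0..r1}" "\<bar>c\<bar> \<le> B"
    by (auto simp: S_def)
  from fp have fr: "max r0 (min r1 (r + p * (sig w - \<sigma>))) = r"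
    and fc: "max (-B) (min B (c - V G c w T)) = c" and fw: "Bcontfun (\<lambda>t. U r c w (cl t)) = w"
    by (simp_all add: \<Phi>_def)
  have w: "continuous_on {0..T} w"
    by simp
  have psi_int: "(\<lambda>x. \<psi> (c + H G w x)) integrable_on {0..T}"
    by (intro integrable_continuous_real psi_H_cont G w)
  \<comment> \<open>If this number were positive, the fixed point equation would force
    \<open>c = -B\<close>; if negative, \<open>c = B\<close>. But then \<open>c + H G w\<close> is
    nonpositive, respectively nonnegative, on the whole interval, and so is the integral of its
    image under \<open>\<psi>\<close>.\<close>
  have "V G c w T = 0"
  proof (rule ccontr)
    assume "V G c w T \<noteq> 0"
    then have "V G c w T > 0 \<and> c = - B \<or> V G c w T < 0 \<and> c = B"
      using fc rc(2) by linarith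
    then consider "V G c w T > 0" "c = - B" | "V G c w T < 0" "c = B"
      by blast
    then show False
    proof cases
      case 1
      have "\<psi> (c + H G w x) \<le> 0" if "x \<in> {0..T}" for x
        using HB[OF w that] 1 psi_mono[of "c + H G w x" 0] psi0 by auto
      then have "V G c w T \<le> integral {0..T} (\<lambda>x. 0)"
        unfolding V_def by (intro integral_le psi_int) auto
      with 1 show False
        by simp
    next
      case 2
      have "\<psi> (c + H G w x) \<ge> 0" if "x \<in> {0..T}" for x
        using HB[OF w that] 2 psi_mono[of 0 "c + H G w x"] psi0 by auto
      then have "V G c w T \<ge> 0"
        unfolding V_def by (intro integral_nonneg psi_int)
      with 2 show False
        by simp
    qed
  qed
  moreover have "w t = r + V G c w t - (INF x\<in>{0..T}. V G c w x - \<alpha> x)" if "t \<in> {0..T}" for t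
  proof -
    have "w t = U r c w (cl t)"
      using fw U_bcont[OF w rc(2,1)] by (metis Bcontfun_inverse)
    then show ?thesis
      by (simp add: cl_id[OF that] U_def m_def)
  qed
  ultimately show thesis
    using that[OF rc(1) w fr[symmetric]] by blast
qed

text \<open>Integral form of the equation, with \<open>F\<close> replaced by an arbitrary function \<open>G\<close>; the parameter
  \<open>s\<close> of the equation is the number \<open>sig u\<close>.\<close>

definition sol where
  "sol G c u \<longleftrightarrow> continuous_on {0..T} u \<and> V G c u T = 0 \<and> (\<forall>t\<in>{0..T}. u t = u 0 + V G c u t)"

lemma sol_cont: "sol G c u \<Longrightarrow> continuous_on {0..T} u"
  by (simp add: sol_def)

lemma sol_eq: "sol G c u \<Longrightarrow> t \<in> {0..T} \<Longrightarrow> u t = u 0 + V G c u t"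
  unfolding sol_def by blast

lemma sol_V_T: "sol G c u \<Longrightarrow> V G c u T = 0"
  by (simp add: sol_def)

lemma sol_periodic: "sol G c u \<Longrightarrow> u T = u 0"
  using sol_eq[of G c u T] sol_V_T[of G c u] T_pos by simp

lemma sol_deriv:
  assumes "continuous_on UNIV G" "sol G c u" "t \<in> {0..T}"
  shows "(u has_real_derivative \<psi> (c + H G u t)) (at t within {0..T})"
proof (rule has_field_derivative_transform_within[OF _ zero_less_one assms(3)])
  show "((\<lambda>t. u 0 + V G c u t) has_real_derivative \<psi> (c + H G u t)) (at t within {0..T})"
    using V_deriv[OF assms(1) sol_cont[OF assms(2)] assms(3), of c]
    by (auto intro!: derivative_eq_intros)
qed (rule sol_eq[OF assms(2), symmetric])

lemma H_periodic: "sol G c u \<Longrightarrow> H G u T = H G u 0"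
  by (simp add: H_def P_T P_0 E_0 E_T sol_periodic)

lemma H_cong: "(\<And>t. t \<in> {0..T} \<Longrightarrow> G (u t) = G' (u t)) \<Longrightarrow> t \<in> {0..T} \<Longrightarrow> H G u t = H G' u t"
  by (simp add: H_def)

text \<open>Undoes the truncation once the solution is known to stay where \<open>G\<close> and
  \<open>F\<close> agree.\<close>

lemma sol_cong:
  assumes "sol G c u" "\<And>t. t \<in> {0..T} \<Longrightarrow> G (u t) = G' (u t)"
  shows "sol G' c u"
proof -
  have "V G c u t = V G' c u t" if "t \<in> {0..T}" for t
    unfolding V_def by (rule integral_cong) (use that H_cong[of G u G', OF assms(2)] in auto)
  note eq = this
  show ?thesis
    unfolding sol_def
  proof (intro conjI ballI)
    show "V G' c u T = 0"
      using eq[of T] sol_V_T[OF assms(1)] T_pos by simp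
    show "u t = u 0 + V G' c u t" if "t \<in> {0..T}" for t
      using sol_eq[OF assms(1) that] eq[OF that] by (simp only:)
  qed (rule sol_cont[OF assms(1)])
qed

section \<open>A priori bound on the oscillation of solutions\<close>

text \<open>Beyond \<open>kosc\<close> the modulus of \<open>\<phi> x\<close> is at least
  \<open>bH + 1\<close>. This exceeds by one the bound \<open>bH\<close> for
  \<open>H G u + G u\<close>, so that after multiplication by u' one copy of |u'| is left over. The
  rest integrates over a period to \<open>osc\<close>.\<close>

definition "kosc = max (\<psi> (bH + 1)) (- \<psi> (- (bH + 1)))"
definition "osc = (bH + 1) * kosc * T"

lemma kosc_nonneg: "kosc \<ge> 0"
  using psi_mono[of 0 "bH + 1"] psi0 bH_nonneg by (simp add: kosc_def le_max_iff_disj)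

lemma phi_coercive: "(bH + 1) * (\<bar>x\<bar> - kosc) \<le> x * \<phi> x"
proof -
  have mono: "\<phi> y \<le> \<phi> z" if "y \<le> z" for y z
    using strict_mono_less_eq[OF phi_mono] that by blast
  consider "x > kosc" | "x < - kosc" | "\<bar>x\<bar> \<le> kosc"
    by linarith
  then show ?thesis
  proof cases
    case 1
    then have "\<psi> (bH + 1) \<le> x"
      by (simp add: kosc_def)
    then have "bH + 1 \<le> \<phi> x"
      using mono phi_psi by metis
    with 1 kosc_nonneg have "x * (bH + 1) \<le> x * \<phi> x"
      by (intro mult_left_mono) auto
    moreover have "(bH + 1) * (\<bar>x\<bar> - kosc) \<le> (bH + 1) * x"
      using 1 kosc_nonneg bH_nonneg by (intro mult_left_mono) auto
    ultimately show ?thesis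
      by (simp add: mult.commute)
  next
    case 2
    then have "x \<le> \<psi> (- (bH + 1))"
      by (simp add: kosc_def)
    then have "\<phi> x \<le> - (bH + 1)"
      using mono phi_psi by metis
    with 2 kosc_nonneg have "x * (- (bH + 1)) \<le> x * \<phi> x"
      by (intro mult_left_mono_neg) auto
    moreover have "(bH + 1) * (\<bar>x\<bar> - kosc) \<le> (bH + 1) * (- x)"
      using 2 kosc_nonneg bH_nonneg by (intro mult_left_mono) auto
    ultimately show ?thesis
      by (simp add: algebra_simps)
  next
    case 3
    have "0 \<le> x * \<phi> x"
      using mono[of 0 x] mono[of x 0] phi0 by (cases "x \<ge> 0") (auto intro: mult_nonpos_nonpos)
    moreover have "(bH + 1) * (\<bar>x\<bar> - kosc) \<le> 0"
      using 3 bH_nonneg by (intro mult_nonneg_nonpos) auto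
    ultimately show ?thesis
      by linarith
  qed
qed

text \<open>The bound does not depend on \<open>G\<close>, because \<open>G u \<cdot> u'\<close> is the derivative of a periodic function.\<close>

lemma sol_oscillation:
  assumes G: "continuous_on UNIV G" and sol: "sol G c u" and st: "s \<in> {0..T}" "t \<in> {0..T}"
  shows "\<bar>u t - u s\<bar> \<le> osc"
proof -
  obtain GG where GG: "\<And>x. (GG has_real_derivative G x) (at x)"
    using antiderivative_UNIV[OF G] by blast
  define u' where "u' t = \<psi> (c + H G u t)" for t
  \<comment> \<open>The derivative of \<open>W\<close> dominates |u'|, so \<open>W - u\<close> and
    \<open>W + u\<close> are nondecreasing and increments of \<open>u\<close> are bounded by those
    of \<open>W\<close>. As \<open>u\<close> is periodic, the total increase of \<open>W\<close> is
    \<open>osc\<close>.\<close>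
  define W where "W t = (bH + 1) * kosc * t + c * u t - GG (u t)" for t
  define W' where "W' t = (bH + 1) * kosc + c * u' t - G (u t) * u' t" for t
  have u': "(u has_real_derivative u' t) (at t within {0..T})" if "t \<in> {0..T}" for t
    using sol_deriv[OF G sol that] by (simp add: u'_def)
  have W: "(W has_real_derivative W' t) (at t within {0..T})" if "t \<in> {0..T}" for t
    unfolding W_def W'_def
    by (rule DERIV_diff[OF DERIV_add[OF DERIV_cmult[OF DERIV_ident] DERIV_cmult[OF u'[OF that]]]
          DERIV_chain2[OF GG u'[OF that]], unfolded mult_1_right])
  have W'_ge: "\<bar>u' t\<bar> \<le> W' t" if "t \<in> {0..T}" for t
  proof -
    have "\<phi> (u' t) = c + (H G u t + G (u t)) - G (u t)"
      by (simp add: u'_def phi_psi)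
    then have "u' t * \<phi> (u' t) = u' t * (c + (H G u t + G (u t)) - G (u t))"
      by (rule arg_cong)
    then have "u' t * \<phi> (u' t) = c * u' t + u' t * (H G u t + G (u t)) - G (u t) * u' t"
      by (simp only: algebra_simps)
    moreover have "u' t * (H G u t + G (u t)) \<le> \<bar>u' t\<bar> * bH"
    proof -
      have "u' t * (H G u t + G (u t)) \<le> \<bar>u' t\<bar> * \<bar>H G u t + G (u t)\<bar>"
        unfolding abs_mult[symmetric] by (rule abs_ge_self)
      also have "\<dots> \<le> \<bar>u' t\<bar> * bH"
        by (intro mult_left_mono H_G_bound sol_cont[OF sol] that) auto
      finally show ?thesis .
    qed
    moreover have "(bH + 1) * (\<bar>u' t\<bar> - kosc) = \<bar>u' t\<bar> * bH + \<bar>u' t\<bar> - (bH + 1) * kosc"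
      by (simp only: algebra_simps)
    ultimately show ?thesis
      using phi_coercive[of "u' t"] unfolding W'_def by linarith
  qed
  have WT: "W T - W 0 = osc"
    by (simp add: W_def osc_def sol_periodic[OF sol])
  have W_mono: "W x \<le> W y" if "0 \<le> x" "x \<le> y" "y \<le> T" for x y
    by (rule deriv_within_nonneg_imp_le[OF W _ that]) (use W'_ge in force)+
  have *: "\<bar>u y - u x\<bar> \<le> W y - W x" if xy: "0 \<le> x" "x \<le> y" "y \<le> T" for x y
  proof -
    have "W x - u x \<le> W y - u y"
      by (rule deriv_within_nonneg_imp_le[OF DERIV_diff[OF W u'] _ xy]) (use W'_ge in force)+
    moreover have "W x + u x \<le> W y + u y"
      by (rule deriv_within_nonneg_imp_le[OF DERIV_add[OF W u'] _ xy]) (use W'_ge in force)+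
    ultimately show ?thesis
      by linarith
  qed
  have "\<bar>u y - u x\<bar> \<le> osc" if "0 \<le> x" "x \<le> y" "y \<le> T" for x y
    using *[OF that] W_mono[of 0 x] W_mono[of y T] that WT by linarith
  from this[of s t] this[of t s] st show ?thesis
    by (cases "s \<le> t") (auto simp: abs_minus_commute)
qed

section \<open>Comparison of the parameters of touching solutions\<close>

text \<open>At a touching point \<open>u\<close> and \<open>\<alpha>\<close> have equal values and
  equal derivatives. If \<open>sig u\<close> were smaller than \<open>sig \<alpha>\<close>, the
  linear term \<open>(sig u - sig \<alpha>) * (t - t0)\<close> would dominate the difference of the
  two integrated equations just to the right; so u' would be below the derivative of
  \<open>\<alpha>\<close> there, and \<open>u\<close> would drop below
  \<open>\<alpha>\<close>.\<close>

lemma sol_touching_below: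
  assumes u: "sol F c u" and \<alpha>: "sol F d \<alpha>"
    and above: "\<And>t. t \<in> {0..T} \<Longrightarrow> \<alpha> t \<le> u t" and touch: "t1 \<in> {0..T}" "u t1 = \<alpha> t1"
  shows "sig \<alpha> \<le> sig u"
proof (rule ccontr)
  assume "\<not> sig \<alpha> \<le> sig u"
  define \<delta> where "\<delta> = sig \<alpha> - sig u"
  have "\<delta> > 0"
    using \<open>\<not> sig \<alpha> \<le> sig u\<close> by (simp add: \<delta>_def)
  define v where "v t = u t - \<alpha> t" for t
  have v_nonneg: "v t \<ge> 0" if "t \<in> {0..T}" for t
    using above[OF that] by (simp add: v_def)
  \<comment> \<open>By periodicity a touching point at \<open>T\<close> can be moved to 0, which
    leaves room on the right. Where room on the left is needed, \<open>t2\<close> makes the opposite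
    choice.\<close>
  define t0 where "t0 = (if t1 = T then 0 else t1)"
  have t0: "0 \<le> t0" "t0 < T" and u_t0: "u t0 = \<alpha> t0"
    using touch T_pos sol_periodic[OF u] sol_periodic[OF \<alpha>] by (auto simp: t0_def split: if_splits)
  define D where "D t = \<psi> (c + H F u t) - \<psi> (d + H F \<alpha> t)" for t
  have v_deriv: "(v has_real_derivative D t) (at t within {0..T})" if "t \<in> {0..T}" for t
    unfolding v_def D_def using that by (intro DERIV_diff sol_deriv F_cont u \<alpha>)
  have "D t0 \<ge> 0"
  proof (rule ccontr)
    assume "\<not> D t0 \<ge> 0"
    then obtain r where "r > 0" and r: "\<And>h. 0 < h \<Longrightarrow> t0 + h \<in> {0..T} \<Longrightarrow> h < r \<Longrightarrow> v (t0 + h) < v t0"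
      using has_real_derivative_neg_dec_right[OF v_deriv[of t0]] t0 by force
    have "v (t0 + min (r/2) (T - t0)) < v t0"
      using \<open>r > 0\<close> t0 by (intro r) auto
    moreover have "v (t0 + min (r/2) (T - t0)) \<ge> 0"
      using \<open>r > 0\<close> t0 by (intro v_nonneg) auto
    ultimately show False
      by (simp add: v_def u_t0)
  qed
  moreover have "D t0 \<le> 0"
  proof (rule ccontr)
    assume pos: "\<not> D t0 \<le> 0"
    define t2 where "t2 = (if t0 = 0 then T else t0)"
    have t2: "0 < t2" "t2 \<le> T" and "D t2 = D t0" and "v t2 = 0"
      using t0 T_pos u_t0 H_periodic[OF u] H_periodic[OF \<alpha>] sol_periodic[OF u] sol_periodic[OF \<alpha>]
      by (auto simp: t2_def D_def v_def)
    with pos obtain r where "r > 0" and r: "\<And>h. 0 < h \<Longrightarrow> t2 - h \<in> {0..T} \<Longrightarrow> h < r \<Longrightarrow> v (t2 - h) < v t2"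
      using has_real_derivative_pos_inc_left[OF v_deriv[of t2]] by force
    have "v (t2 - min (r/2) t2) < v t2"
      using \<open>r > 0\<close> t2 by (intro r) auto
    moreover have "v (t2 - min (r/2) t2) \<ge> 0"
      using \<open>r > 0\<close> t2 by (intro v_nonneg) auto
    ultimately show False
      by (simp add: \<open>v t2 = 0\<close>)
  qed
  ultimately have D0: "D t0 = 0"
    by simp
  then have H0: "c + H F u t0 = d + H F \<alpha> t0"
    unfolding D_def by (metis eq_iff_diff_eq_0 phi_psi)
  \<comment> \<open>\<open>F (u t)\<close> and \<open>F (\<alpha> t)\<close> have the same
    derivative at \<open>t0\<close>, so \<open>g\<close> is small compared with
    \<open>t - t0\<close>.\<close>
  define g where "g t = F (u t) - F (\<alpha> t)" for t
  have "(g has_real_derivative f (u t0) * \<psi> (c + H F u t0) - f (\<alpha> t0) * \<psi> (d + H F \<alpha> t0)) (at t0 within {0..T})"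
    unfolding g_def using t0
    by (intro DERIV_diff DERIV_chain2[OF F_deriv] sol_deriv F_cont u \<alpha>) auto
  then have g_deriv: "(g has_real_derivative 0) (at t0 within {0..T})"
    using D0 by (simp add: u_t0 D_def flip: right_diff_distrib)
  have "\<delta> / 4 > 0"
    using \<open>\<delta> > 0\<close> by simp
  with g_deriv obtain r1 where "r1 > 0"
    and r1: "\<And>t. t \<in> {0..T} \<Longrightarrow> \<bar>t - t0\<bar> < r1 \<Longrightarrow> \<bar>g t - g t0\<bar> \<le> \<delta> / 4 * \<bar>t - t0\<bar>"
    unfolding has_field_derivative_def has_derivative_within_alt by fastforce
  have A: "A \<ge> 0"
    using e_bound[of 0] T_pos by auto
  \<comment> \<open>Of the slope \<open>\<delta>\<close>, the difference of the \<open>P\<close>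
    terms may consume \<open>\<delta> / 2\<close> and \<open>g\<close> may consume
    \<open>\<delta> / 4\<close>, so \<open>\<delta> / 4\<close> remains. Dividing by
    \<open>A + 1\<close> covers \<open>A = 0\<close>.\<close>
  define \<eta> where "\<eta> = \<delta> / (2 * (A + 1))"
  have "\<eta> > 0" and eta: "A * \<eta> \<le> \<delta> / 2"
    using \<open>\<delta> > 0\<close> A by (auto simp: \<eta>_def field_simps)
  have "continuous_on {0..T} (\<lambda>t. q (u t) - q (\<alpha> t))"
    by (intro continuous_intros q_comp_cont sol_cont[OF u] sol_cont[OF \<alpha>])
  moreover have "t0 \<in> {0..T}"
    using t0 by auto
  ultimately obtain r2 where "r2 > 0" and "\<forall>t\<in>{0..T}. dist t t0 < r2 \<longrightarrow>
      dist (q (u t) - q (\<alpha> t)) (q (u t0) - q (\<alpha> t0)) < \<eta>"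
    using \<open>\<eta> > 0\<close> unfolding continuous_on_iff by blast
  then have r2: "\<bar>q (u t) - q (\<alpha> t)\<bar> < \<eta>" if "t \<in> {0..T}" "\<bar>t - t0\<bar> < r2" for t
    using that by (simp add: dist_real_def u_t0)
  define r where "r = min (T - t0) (min r1 r2) / 2"
  have "r > 0"
    using t0 \<open>r1 > 0\<close> \<open>r2 > 0\<close> by (simp add: r_def)
  have r_le: "2 * r \<le> T - t0" "2 * r \<le> r1" "2 * r \<le> r2"
    by (auto simp: r_def)
  have D_neg: "D t < 0" if t: "t0 < t" "t \<le> t0 + r" for t
  proof -
    have tT: "t \<in> {0..T}" "\<bar>t - t0\<bar> < r1" "\<bar>t - t0\<bar> < r2"
      using t t0 \<open>r > 0\<close> r_le by auto
    have "P u t - P \<alpha> t - (P u t0 - P \<alpha> t0) = integral {t0..t} (\<lambda>x. a x * (q (u x) - q (\<alpha> x)))"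
    proof -
      have split: "P w t - P w t0 = integral {t0..t} (\<lambda>x. a x * q (w x))" if "continuous_on {0..T} w" for w
      proof -
        have "integral {0..t0} (\<lambda>x. a x * q (w x)) + integral {t0..t} (\<lambda>x. a x * q (w x))
            = integral {0..t} (\<lambda>x. a x * q (w x))"
          by (rule Henstock_Kurzweil_Integration.integral_combine)
            (use t t0 tT integrable_on_subinterval[OF aq_integrable[OF that]] in auto)
        then show ?thesis
          by (simp add: P_def)
      qed
      have "(\<lambda>x. a x * q (w x)) integrable_on {t0..t}" if "continuous_on {0..T} w" for w
        using integrable_on_subinterval[OF aq_integrable[OF that]] t0 tT by auto
      then show ?thesis
        using split[OF sol_cont[OF u]] split[OF sol_cont[OF \<alpha>]] sol_cont[OF u] sol_cont[OF \<alpha>]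
        by (simp add: right_diff_distrib integral_diff)
    qed
    moreover have "norm (integral {t0..t} (\<lambda>x. a x * (q (u x) - q (\<alpha> x)))) \<le> integral {t0..t} (\<lambda>x. A * \<eta>)"
    proof (rule integral_norm_bound_integral)
      show "(\<lambda>x. a x * (q (u x) - q (\<alpha> x))) integrable_on {t0..t}"
        using t0 tT
        by (intro integrable_on_subinterval[OF weighted_integrable] continuous_intros q_comp_cont sol_cont[OF u] sol_cont[OF \<alpha>]) auto
      fix x assume "x \<in> {t0..t}"
      then have "x \<in> {0..T}" "\<bar>x - t0\<bar> < r2"
        using t0 tT by auto
      then show "norm (a x * (q (u x) - q (\<alpha> x))) \<le> A * \<eta>"
        using r2[of x] a_bound[of x] A by (auto simp: abs_mult intro!: mult_mono)
    qed auto
    moreover have "integral {t0..t} (\<lambda>x. A * \<eta>) = A * \<eta> * (t - t0)"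
      using t by simp
    moreover have "A * \<eta> * (t - t0) \<le> \<delta> / 2 * (t - t0)"
      using eta t by (intro mult_right_mono) auto
    ultimately have Pdiff: "\<bar>P u t - P \<alpha> t - (P u t0 - P \<alpha> t0)\<bar> \<le> \<delta> / 2 * (t - t0)"
      unfolding real_norm_def by linarith
    have gt: "\<bar>g t\<bar> \<le> \<delta> / 4 * (t - t0)"
      using r1[OF tT(1,2)] t by (simp add: g_def u_t0)
    have "(c + H F u t) - (d + H F \<alpha> t) = (c + H F u t) - (d + H F \<alpha> t) - ((c + H F u t0) - (d + H F \<alpha> t0))"
      using H0 by simp
    also have "\<dots> = - \<delta> * (t - t0) - (P u t - P \<alpha> t - (P u t0 - P \<alpha> t0)) - g t"
      by (simp add: H_def \<delta>_def g_def u_t0 algebra_simps)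
    also have "\<dots> \<le> - (\<delta> / 4) * (t - t0)"
    proof -
      have e: "\<delta> / 2 * (t - t0) = \<delta> * (t - t0) / 2" "\<delta> / 4 * (t - t0) = \<delta> * (t - t0) / 4"
        "- \<delta> * (t - t0) = - (\<delta> * (t - t0))" "- (\<delta> / 4) * (t - t0) = - (\<delta> * (t - t0) / 4)"
        by auto
      show ?thesis
        using Pdiff gt unfolding e by linarith
    qed
    also have "\<dots> < 0"
      using \<open>\<delta> > 0\<close> t by (simp add: mult_neg_pos)
    finally show ?thesis
      using psi_strict_mono[of "c + H F u t" "d + H F \<alpha> t"] by (simp add: D_def)
  qed
  have "v (t0 + r) < v t0"
  proof (rule DERIV_neg_imp_decreasing_open[where f = v])
    show "t0 < t0 + r"
      using \<open>r > 0\<close> by simp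
    fix x assume x: "t0 < x" "x < t0 + r"
    then have "0 < x" "x < T"
      using t0 \<open>r > 0\<close> r_le by auto
    then show "\<exists>y. (v has_real_derivative y) (at x) \<and> y < 0"
      using v_deriv[of x] D_neg[of x] x by (auto simp: at_within_Icc_at)
  next
    show "continuous_on {t0..t0 + r} v"
      by (rule continuous_on_subset[OF DERIV_continuous_on[OF v_deriv]])
        (use t0 \<open>r > 0\<close> r_le in auto)
  qed
  moreover have "v (t0 + r) \<ge> 0"
    using t0 \<open>r > 0\<close> by (intro v_nonneg) (use r_le in auto)
  ultimately show False
    by (simp add: v_def u_t0)
qed

section \<open>Equivalence of the integral form with the differential equation\<close>

text \<open>Absolute continuity permits integrating the almost everywhere equation over [0,t]; the
  case \<open>t = T\<close> identifies the parameter.\<close>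

lemma periodic_solution_imp_sol:
  assumes "periodic_solution \<phi> f a q e T s u"
  obtains c where "sol F c u" "sig u = s"
proof -
  obtain u' where u': "\<And>t. t \<in> {0..T} \<Longrightarrow> (u has_real_derivative u' t) (at t within {0..T})"
    and u'_cont: "continuous_on {0..T} u'" and per: "u 0 = u T" "u' 0 = u' T"
    and ac: "abs_continuous_on {0..T} (\<lambda>t. \<phi> (u' t))"
    and ae: "AE t in lebesgue. t \<in> {0..T} \<longrightarrow>
              ((\<lambda>t. \<phi> (u' t)) has_real_derivative
                 (s + e t - f (u t) * u' t - a t * q (u t))) (at t within {0..T})"
    using assms unfolding periodic_solution_def by blast
  have u: "continuous_on {0..T} u"
    by (rule DERIV_continuous_on[OF u'])
  have phi_eq: "\<phi> (u' t) - \<phi> (u' 0) = s * t + E t - (F (u t) - F (u 0)) - P u t" if t: "t \<in> {0..T}" for t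
  proof -
    have sub: "{0..t} \<subseteq> {0..T}"
      using t by auto
    have "((\<lambda>x. s + e x - f (u x) * u' x - a x * q (u x)) has_integral \<phi> (u' t) - \<phi> (u' 0)) {0..t}"
    proof (rule fundamental_theorem_of_calculus_abs_continuous)
      show "abs_continuous_on {0..t} (\<lambda>t. \<phi> (u' t))"
        by (rule abs_continuous_on_subset[OF ac sub])
      show "AE x in lebesgue. x \<in> {0..t} \<longrightarrow> ((\<lambda>t. \<phi> (u' t)) has_real_derivative
                 (s + e x - f (u x) * u' x - a x * q (u x))) (at x within {0..t})"
        using ae by eventually_elim (use sub in \<open>auto intro: has_field_derivative_subset\<close>)
    qed (use t in auto)
    moreover have "((\<lambda>x. s + e x - f (u x) * u' x - a x * q (u x)) has_integral
        (s * t + E t - (F (u t) - F (u 0)) - P u t)) {0..t}"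
    proof (intro has_integral_diff has_integral_add)
      show "((\<lambda>x. s) has_integral s * t) {0..t}"
        using has_integral_const_real[of s 0 t] t by (simp add: mult.commute)
      show "(e has_integral E t) {0..t}"
        unfolding E_def using integrable_on_subinterval[OF e_int] t by (intro integrable_integral) auto
      show "((\<lambda>x. f (u x) * u' x) has_integral F (u t) - F (u 0)) {0..t}"
      proof (rule fundamental_theorem_of_calculus)
        fix x assume "x \<in> {0..t}"
        then have "(u has_real_derivative u' x) (at x within {0..t})"
          using u'[of x] sub by (auto intro: has_field_derivative_subset)
        from DERIV_chain2[OF F_deriv this]
        show "((\<lambda>x. F (u x)) has_vector_derivative f (u x) * u' x) (at x within {0..t})"
          by (simp add: has_real_derivative_iff_has_vector_derivative)
      qed (use t in auto)
      show "((\<lambda>x. a x * q (u x)) has_integral P u t) {0..t}"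
        unfolding P_def using integrable_on_subinterval[OF aq_integrable[OF u]] t
        by (intro integrable_integral) auto
    qed
    ultimately show ?thesis
      by (rule has_integral_unique)
  qed
  have "s * T = P u T"
    using phi_eq[of T] per T_pos by (simp add: E_T)
  then have sig: "sig u = s"
    using T_pos by (simp add: P_T)
  \<comment> \<open>At time 0 all terms of \<open>H F u\<close> vanish except
    \<open>- F (u 0)\<close>.\<close>
  define c where "c = \<phi> (u' 0) + F (u 0)"
  have u'_eq: "u' t = \<psi> (c + H F u t)" if "t \<in> {0..T}" for t
  proof -
    have "\<phi> (u' t) = c + H F u t"
      using phi_eq[OF that] by (simp add: c_def H_def sig)
    then show ?thesis
      by (metis psi_phi)
  qed
  have V_eq: "V F c u t = u t - u 0" if t: "t \<in> {0..T}" for t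
    unfolding V_def
  proof (rule integral_unique, rule fundamental_theorem_of_calculus)
    fix x assume "x \<in> {0..t}"
    then have x: "x \<in> {0..T}"
      using t by auto
    then have "(u has_real_derivative \<psi> (c + H F u x)) (at x within {0..t})"
      using u'[OF x] u'_eq[OF x] t has_field_derivative_subset[of u _ x "{0..T}" "{0..t}"] by auto
    then show "(u has_vector_derivative \<psi> (c + H F u x)) (at x within {0..t})"
      by (simp add: has_real_derivative_iff_has_vector_derivative)
  qed (use t in auto)
  have "sol F c u"
    unfolding sol_def using u V_eq per T_pos by simp
  then show thesis
    using that sig by blast
qed

text \<open>Since \<open>a\<close>, \<open>q\<close> and \<open>e\<close> are bounded and
  \<open>f (u t)\<close> times the derivative of \<open>u\<close> is continuous, phi(u') is even
  Lipschitz. The equation holds wherever the integrals \<open>P u\<close> and \<open>E\<close> have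
  the expected derivatives.\<close>

lemma sol_imp_periodic_solution:
  assumes sol: "sol F c u"
  shows "periodic_solution \<phi> f a q e T (sig u) u"
  unfolding periodic_solution_def
proof (intro exI conjI ballI)
  have u: "continuous_on {0..T} u"
    by (rule sol_cont[OF sol])
  show u': "(u has_real_derivative \<psi> (c + H F u t)) (at t within {0..T})" if "t \<in> {0..T}" for t
    by (rule sol_deriv[OF F_cont sol that])
  show "continuous_on {0..T} (\<lambda>t. \<psi> (c + H F u t))"
    by (intro psi_H_cont F_cont u)
  show "u 0 = u T" "\<psi> (c + H F u 0) = \<psi> (c + H F u T)"
    using sol_periodic[OF sol] H_periodic[OF sol] by auto
  have f_u': "continuous_on {0..T} (\<lambda>t. f (u t) * \<psi> (c + H F u t))"
    by (intro continuous_intros psi_H_cont F_cont u continuous_on_compose2[OF f_cont u]) auto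
  have Fu: "((\<lambda>t. F (u t)) has_real_derivative f (u t) * \<psi> (c + H F u t)) (at t within {0..T})"
    if "t \<in> {0..T}" for t
    by (rule DERIV_chain2[OF F_deriv u'[OF that]])
  obtain K where K: "\<forall>t\<in>{0..T}. \<bar>f (u t) * \<psi> (c + H F u t)\<bar> \<le> K"
    using compact_imp_bounded[OF compact_continuous_image[OF f_u']] unfolding bounded_iff by auto
  show "abs_continuous_on {0..T} (\<lambda>t. \<phi> (\<psi> (c + H F u t)))"
  proof (rule lipschitz_imp_abs_continuous_on[of _ _ "\<bar>sig u\<bar> + A * Q + K + A"])
    fix s t assume st: "s \<in> {0..T}" "t \<in> {0..T}"
    have Pst: "\<bar>P u t - P u s\<bar> \<le> A * Q * \<bar>t - s\<bar>"
      unfolding P_def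
    proof (rule integral_lipschitz[OF aq_integrable[OF u] _ st])
      show "\<bar>a x * q (u x)\<bar> \<le> A * Q" if "x \<in> {0..T}" for x
        using a_bound[OF that] q_le_Q[of "u x"] by (auto simp: abs_mult intro!: mult_mono)
    qed
    have Est: "\<bar>E t - E s\<bar> \<le> A * \<bar>t - s\<bar>"
      unfolding E_def by (rule integral_lipschitz[OF e_int e_bound st])
    have Fst: "norm (F (u t) - F (u s)) \<le> K * norm (t - s)"
      by (rule field_differentiable_bound[OF _ Fu _ st(2,1)]) (use K in auto)
    have four: "\<bar>w - x - y + z\<bar> \<le> \<bar>w\<bar> + \<bar>x\<bar> + \<bar>y\<bar> + \<bar>z\<bar>" for w x y z :: real
      by linarith
    have split: "\<phi> (\<psi> (c + H F u t)) - \<phi> (\<psi> (c + H F u s))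
        = sig u * (t - s) - (P u t - P u s) - (F (u t) - F (u s)) + (E t - E s)"
      by (simp add: phi_psi H_def right_diff_distrib)
    have "\<bar>\<phi> (\<psi> (c + H F u t)) - \<phi> (\<psi> (c + H F u s))\<bar>
        \<le> \<bar>sig u * (t - s)\<bar> + \<bar>P u t - P u s\<bar> + \<bar>F (u t) - F (u s)\<bar> + \<bar>E t - E s\<bar>"
      unfolding split by (rule four)
    also have "\<dots> \<le> \<bar>sig u\<bar> * \<bar>t - s\<bar> + A * Q * \<bar>t - s\<bar> + K * \<bar>t - s\<bar> + A * \<bar>t - s\<bar>"
      using Pst Est Fst by (intro add_mono) (auto simp: abs_mult)
    finally show "\<bar>\<phi> (\<psi> (c + H F u t)) - \<phi> (\<psi> (c + H F u s))\<bar> \<le> (\<bar>sig u\<bar> + A * Q + K + A) * \<bar>t - s\<bar>"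
      by (simp only: distrib_right)
  qed
  show "AE t in lebesgue. t \<in> {0..T} \<longrightarrow>
      ((\<lambda>t. \<phi> (\<psi> (c + H F u t))) has_real_derivative
        (sig u + e t - f (u t) * \<psi> (c + H F u t) - a t * q (u t))) (at t within {0..T})"
    using AE_has_derivative_integral[OF aq_integrable[OF u]] AE_has_derivative_integral[OF e_int]
  proof eventually_elim
    case (elim t)
    show ?case
    proof
      assume t: "t \<in> {0..T}"
      then have "(P u has_real_derivative a t * q (u t)) (at t within {0..T})"
        and "(E has_real_derivative e t) (at t within {0..T})"
        using elim unfolding P_def[abs_def] E_def[abs_def] by auto
      note d = this Fu[OF t]
      show "((\<lambda>t. \<phi> (\<psi> (c + H F u t))) has_real_derivative
        (sig u + e t - f (u t) * \<psi> (c + H F u t) - a t * q (u t))) (at t within {0..T})"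
      proof -
        have "(\<lambda>t. \<phi> (\<psi> (c + H F u t))) = (\<lambda>t. c + (sig u * t - P u t - F (u t) + E t))"
          by (simp add: phi_psi H_def)
        moreover have "((\<lambda>t. c + (sig u * t - P u t - F (u t) + E t)) has_real_derivative
          (sig u + e t - f (u t) * \<psi> (c + H F u t) - a t * q (u t))) (at t within {0..T})"
          using DERIV_add[OF DERIV_const[of c] DERIV_add[OF DERIV_diff[OF DERIV_diff[OF
            DERIV_cmult[OF DERIV_ident, of "sig u"] d(1)] d(3)] d(2)]]
          by (simp add: algebra_simps)
        ultimately show ?thesis
          by simp
      qed
    qed
  qed
qed

section \<open>Solutions with prescribed minimum relative to a given function\<close>

text \<open>\<open>G\<close> is \<open>F\<close> frozen outside \<open>{-M..M}\<close>, hence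
  bounded. The fixed point \<open>w\<close> touches \<open>\<alpha> + r\<close> and oscillates by at
  most \<open>osc\<close> for any choice of \<open>G\<close>, so \<open>M\<close> can be fixed
  beforehand such that \<open>w\<close> never leaves the region where \<open>G\<close> equals
  \<open>F\<close>.\<close>

lemma sol_with_minimum:
  assumes \<alpha>: "continuous_on {0..T} \<alpha>" and "r0 \<le> r1"
  obtains r c w t0 where "r \<in> {r0..r1}" "sol F c w" "r = max r0 (min r1 (r + p * (sig w - \<sigma>)))"
    "\<forall>t\<in>{0..T}. \<alpha> t + r \<le> w t" "t0 \<in> {0..T}" "w t0 = \<alpha> t0 + r"
proof -
  obtain b where "\<forall>t\<in>{0..T}. \<bar>\<alpha> t\<bar> \<le> b"
    using compact_imp_bounded[OF compact_continuous_image[OF \<alpha>]] unfolding bounded_iff by auto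
  then have b: "\<bar>\<alpha> t\<bar> \<le> b" if "t \<in> {0..T}" for t
    using that by blast
  define M where "M = max \<bar>r0\<bar> \<bar>r1\<bar> + b + osc"
  define G where "G u = F (max (- M) (min M u))" for u
  have "continuous_on UNIV G"
    unfolding G_def by (rule continuous_on_compose2[OF F_cont[of UNIV]]) (auto intro!: continuous_intros)
  have "bounded (F ` {-\<bar>M\<bar>..\<bar>M\<bar>})"
    by (intro compact_imp_bounded compact_continuous_image F_cont) auto
  then obtain bG where bG: "\<forall>u\<in>{-\<bar>M\<bar>..\<bar>M\<bar>}. \<bar>F u\<bar> \<le> bG"
    by (auto simp: bounded_iff)
  have G_le: "\<bar>G u\<bar> \<le> bG" for u
    unfolding G_def by (rule bG[rule_format]) auto
  obtain r c w where r: "r \<in> {r0..r1}" and w: "continuous_on {0..T} w"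
    and clamp: "r = max r0 (min r1 (r + p * (sig w - \<sigma>)))" and VT: "V G c w T = 0"
    and "\<forall>t\<in>{0..T}. w t = r + V G c w t - (INF x\<in>{0..T}. V G c w x - \<alpha> x)"
    by (rule lienard_fixpoint[OF \<open>continuous_on UNIV G\<close> G_le \<alpha> \<open>r0 \<le> r1\<close>, where p = p and \<sigma> = \<sigma>])
  then have fixp: "w t = r + V G c w t - (INF x\<in>{0..T}. V G c w x - \<alpha> x)" if "t \<in> {0..T}" for t
    using that by blast
  define m where "m = (INF x\<in>{0..T}. V G c w x - \<alpha> x)"
  have "continuous_on {0..T} (\<lambda>x. V G c w x - \<alpha> x)"
    by (intro continuous_intros V_cont \<alpha> w) fact
  then have "\<exists>x\<in>{0..T}. \<forall>y\<in>{0..T}. V G c w x - \<alpha> x \<le> V G c w y - \<alpha> y"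
    using T_pos by (intro continuous_attains_inf) auto
  then obtain t0 where t0: "t0 \<in> {0..T}"
    and "\<forall>t\<in>{0..T}. V G c w t0 - \<alpha> t0 \<le> V G c w t - \<alpha> t"
    by blast
  then have min: "V G c w t0 - \<alpha> t0 \<le> V G c w t - \<alpha> t" if "t \<in> {0..T}" for t
    using that by blast
  have m: "m = V G c w t0 - \<alpha> t0"
    unfolding m_def by (rule cInf_eq_minimum) (use t0 min in auto)
  have above: "\<alpha> t + r \<le> w t" if "t \<in> {0..T}" for t
    using fixp[OF that] min[OF that] m by (simp flip: m_def)
  have touch: "w t0 = \<alpha> t0 + r"
    using fixp[OF t0] m by (simp flip: m_def)
  have "w t = w 0 + V G c w t" if "t \<in> {0..T}" for t
    using fixp[OF that] fixp[of 0] T_pos by (simp add: V_0)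
  then have sol: "sol G c w"
    unfolding sol_def using w VT by blast
  have wM: "\<bar>w t\<bar> \<le> M" if "t \<in> {0..T}" for t
    using sol_oscillation[OF \<open>continuous_on UNIV G\<close> sol t0 that] touch b[OF t0] r
    by (auto simp: M_def)
  have "sol F c w"
  proof (rule sol_cong[OF sol])
    show "G (w t) = F (w t)" if "t \<in> {0..T}" for t
      using wM[OF that] by (auto simp: G_def abs_le_iff min_def max_def)
  qed
  with r clamp above t0 touch show thesis
    using that by blast
qed

section \<open>The parameter as a weighted mean of q\<close>

lemma sig_le:
  assumes "continuous_on {0..T} w" "\<And>t. t \<in> {0..T} \<Longrightarrow> q (w t) \<le> m"
  shows "sig w \<le> m"
proof -
  have "P w T \<le> integral {0..T} (\<lambda>x. m * a x)"
    unfolding P_def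
    by (intro integral_le aq_integrable assms integrable_on_mult_right a_int)
      (use mult_left_mono[OF assms(2) a_nonneg] in \<open>simp add: mult.commute\<close>)
  then show ?thesis
    using T_pos by (simp add: P_T a_mean integral_mult_right)
qed

lemma sig_ge:
  assumes "continuous_on {0..T} w" "\<And>t. t \<in> {0..T} \<Longrightarrow> m \<le> q (w t)"
  shows "m \<le> sig w"
proof -
  have "integral {0..T} (\<lambda>x. m * a x) \<le> P w T"
    unfolding P_def
    by (intro integral_le aq_integrable assms integrable_on_mult_right a_int)
      (use mult_left_mono[OF assms(2) a_nonneg] in \<open>simp add: mult.commute\<close>)
  then show ?thesis
    using T_pos by (simp add: P_T a_mean integral_mult_right)
qed

text \<open>The inequality stays strict because \<open>q (w t)\<close> attains its minimum on the
  compact interval.\<close>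

lemma sig_gt:
  assumes w: "continuous_on {0..T} w" and gt: "\<And>t. t \<in> {0..T} \<Longrightarrow> q (w t) > \<omega>"
  shows "sig w > \<omega>"
proof -
  obtain t0 where "t0 \<in> {0..T}" "\<forall>t\<in>{0..T}. q (w t0) \<le> q (w t)"
    using continuous_attains_inf[OF compact_Icc _ q_comp_cont[OF w]] T_pos by auto
  then show ?thesis
    using sig_ge[OF w, of "q (w t0)"] gt[of t0] by auto
qed

text \<open>Decides the sign of \<open>sig w - s\<close> at the outer ends of the intervals for r,
  and keeps a maximising sequence from escaping to infinity. The midpoint \<open>m\<close> preserves
  strictness under averaging.\<close>

lemma sig_far:
  assumes "\<omega> < s"
  obtains N where "N \<ge> 0" "\<And>w. continuous_on {0..T} w \<Longrightarrow> (\<And>t. t \<in> {0..T} \<Longrightarrow> w t \<ge> N) \<Longrightarrow> sig w < s"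
    "\<And>w. continuous_on {0..T} w \<Longrightarrow> (\<And>t. t \<in> {0..T} \<Longrightarrow> w t \<le> - N) \<Longrightarrow> sig w < s"
proof -
  define m where "m = (\<omega> + s) / 2"
  have m: "\<omega> < m" "m < s"
    using assms by (auto simp: m_def)
  obtain R1 where R1: "\<And>u. u \<ge> R1 \<Longrightarrow> q u < m"
    using order_tendstoD(2)[OF q_top m(1)] by (auto simp: eventually_at_top_linorder)
  obtain R2 where R2: "\<And>u. u \<le> R2 \<Longrightarrow> q u < m"
    using order_tendstoD(2)[OF q_bot m(1)] by (auto simp: eventually_at_bot_linorder)
  define N where "N = max 0 (max R1 (- R2))"
  have "R1 \<le> N" "- N \<le> R2"
    by (auto simp: N_def)
  then have N: "u \<ge> N \<Longrightarrow> q u \<le> m" "u \<le> - N \<Longrightarrow> q u \<le> m" for u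
    using R1[of u] R2[of u] by force+
  show thesis
  proof (rule that[of N])
    fix w :: "real \<Rightarrow> real" assume w: "continuous_on {0..T} w"
    show "sig w < s" if "\<And>t. t \<in> {0..T} \<Longrightarrow> w t \<ge> N"
      using sig_le[OF w, of m] N(1) that m(2) by fastforce
    show "sig w < s" if "\<And>t. t \<in> {0..T} \<Longrightarrow> w t \<le> - N"
      using sig_le[OF w, of m] N(2) that m(2) by fastforce
  qed (simp add: N_def)
qed

lemma osc_nonneg: "osc \<ge> 0"
  using bH_nonneg kosc_nonneg T_pos by (simp add: osc_def)

section \<open>Two solutions below an attained parameter\<close>

lemma two_solutions:
  assumes \<alpha>: "sol F d \<alpha>" and s: "\<omega> < s" "s < sig \<alpha>"
  obtains c1 u1 c2 u2 t where "sol F c1 u1" "sig u1 = s" "sol F c2 u2" "sig u2 = s"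
    "t \<in> {0..T}" "u1 t \<noteq> u2 t"
proof -
  note \<alpha>_cont = sol_cont[OF \<alpha>]
  obtain b where "\<forall>t\<in>{0..T}. \<bar>\<alpha> t\<bar> \<le> b"
    using compact_imp_bounded[OF compact_continuous_image[OF \<alpha>_cont]] unfolding bounded_iff by auto
  then have b: "\<bar>\<alpha> t\<bar> \<le> b" if "t \<in> {0..T}" for t
    using that by blast
  obtain N where "N \<ge> 0"
    and N1: "\<And>w. continuous_on {0..T} w \<Longrightarrow> (\<And>t. t \<in> {0..T} \<Longrightarrow> w t \<ge> N) \<Longrightarrow> sig w < s"
    and N2: "\<And>w. continuous_on {0..T} w \<Longrightarrow> (\<And>t. t \<in> {0..T} \<Longrightarrow> w t \<le> - N) \<Longrightarrow> sig w < s"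
    using sig_far[OF s(1)] by blast
  \<comment> \<open>At \<open>r = N'\<close> the solution lies above \<open>N\<close> because
    \<open>\<alpha>\<close> is at least \<open>-b\<close>. At \<open>r = -N'\<close> it lies below
    \<open>-N\<close> because it exceeds its value at the touching point by at most
    \<open>osc\<close>.\<close>
  define N' where "N' = N + b + osc + 1"
  have "N' > 0"
    using \<open>N \<ge> 0\<close> b[of 0] osc_nonneg T_pos by (auto simp: N'_def)
  obtain r1 c1 u1 t1 where r1: "r1 \<in> {0..N'}" and u1: "sol F c1 u1"
    and clamp1: "r1 = max 0 (min N' (r1 + 1 * (sig u1 - s)))"
    and above1: "\<forall>t\<in>{0..T}. \<alpha> t + r1 \<le> u1 t" and t1: "t1 \<in> {0..T}" "u1 t1 = \<alpha> t1 + r1"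
    using sol_with_minimum[OF \<alpha>_cont, where p = 1 and \<sigma> = s, OF less_imp_le[OF \<open>N' > 0\<close>]] by blast
  \<comment> \<open>At \<open>r1 = 0\<close> the solution touches \<open>\<alpha>\<close>, so its
    parameter is at least \<open>sig \<alpha> > s\<close> and the push would move \<open>r1\<close>
    to the right.\<close>
  have "r1 \<noteq> 0"
    using sol_touching_below[OF u1 \<alpha> _ t1(1)] above1 t1 clamp1 \<open>N' > 0\<close> s(2) by force
  moreover have "r1 \<noteq> N'" if "sig u1 \<ge> s"
  proof
    assume "r1 = N'"
    then have "u1 t \<ge> N" if "t \<in> {0..T}" for t
      using bspec[OF above1 that] b[OF that] osc_nonneg by (simp add: N'_def)
    then have "sig u1 < s"
      by (rule N1[OF sol_cont[OF u1]])
    with that show False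
      by simp
  qed
  ultimately have sig1: "sig u1 = s" and "r1 > 0"
    using r1 clamp1 by (auto simp: max_def min_def split: if_splits)
  \<comment> \<open>Here the large parameter belongs to the right end of the interval, so the push
    must be reversed.\<close>
  obtain r2 c2 u2 t2 where r2: "r2 \<in> {-N'..0}" and u2: "sol F c2 u2"
    and clamp2: "r2 = max (-N') (min 0 (r2 + (-1) * (sig u2 - s)))"
    and above2: "\<forall>t\<in>{0..T}. \<alpha> t + r2 \<le> u2 t" and t2: "t2 \<in> {0..T}" "u2 t2 = \<alpha> t2 + r2"
    using sol_with_minimum[OF \<alpha>_cont, where p = "-1" and \<sigma> = s and ?r0.0 = "-N'" and ?r1.0 = 0] \<open>N' > 0\<close>
    by (metis less_imp_le neg_le_0_iff_le)
  have "r2 \<noteq> 0"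
    using sol_touching_below[OF u2 \<alpha> _ t2(1)] above2 t2 clamp2 \<open>N' > 0\<close> s(2) by force
  moreover have "r2 \<noteq> -N'" if "sig u2 \<ge> s"
  proof
    assume "r2 = -N'"
    then have "u2 t \<le> -N" if "t \<in> {0..T}" for t
      using sol_oscillation[OF F_cont u2 t2(1) that] t2(2) b[OF t2(1)] by (simp add: N'_def)
    then have "sig u2 < s"
      by (rule N2[OF sol_cont[OF u2]])
    with that show False
      by simp
  qed
  ultimately have sig2: "sig u2 = s" and "r2 < 0"
    using r2 clamp2 by (auto simp: max_def min_def split: if_splits)
  \<comment> \<open>At \<open>t2\<close> the graph of \<open>\<alpha>\<close> separates the two
    solutions.\<close>
  have "u1 t2 \<noteq> u2 t2"
    using bspec[OF above1 t2(1)] t2(2) \<open>r1 > 0\<close> \<open>r2 < 0\<close> by simp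
  then show thesis
    using that u1 sig1 u2 sig2 t2(1) by blast
qed

section \<open>A solution with the largest parameter\<close>

text \<open>The interval for \<open>r\<close> shrinks to the point \<open>\<bar>R\<bar>\<close>, so
  the solution stays where \<open>q\<close> exceeds \<open>\<omega>\<close>; with
  \<open>p = 0\<close> the clamping condition is trivial.\<close>

lemma exists_sol_above:
  assumes "\<exists>R. \<forall>u. \<bar>u\<bar> \<ge> R \<longrightarrow> q u > \<omega>"
  obtains c u where "sol F c u" "sig u > \<omega>"
proof -
  obtain R where R: "\<And>u. \<bar>u\<bar> \<ge> R \<Longrightarrow> q u > \<omega>"
    using assms by blast
  obtain r c w where r: "r \<in> {\<bar>R\<bar>..\<bar>R\<bar>}" and "sol F c w" and w: "\<forall>t\<in>{0..T}. 0 + r \<le> w t"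
    by (rule sol_with_minimum[OF continuous_on_const order_refl, where p = 0 and \<sigma> = 0])
  have "q (w t) > \<omega>" if "t \<in> {0..T}" for t
    using R[of "w t"] bspec[OF w that] r by auto
  then have "sig w > \<omega>"
    using \<open>sol F c w\<close> by (intro sig_gt sol_cont)
  with \<open>sol F c w\<close> show thesis
    using that by blast
qed

text \<open>\<open>\<psi> (c + H G u x)\<close> has integral zero, so \<open>c + H G u\<close>
  cannot have a constant strict sign, as it would if \<open>\<bar>c\<bar>\<close> exceeded
  \<open>B\<close>.\<close>

lemma sol_const_bound:
  assumes G: "continuous_on UNIV G" and sol: "sol G c u" and B: "\<And>t. t \<in> {0..T} \<Longrightarrow> \<bar>H G u t\<bar> \<le> B"
  shows "\<bar>c\<bar> \<le> B"
proof -
  have int: "(\<lambda>x. \<psi> (c + H G u x)) integrable_on {0..T}"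
    by (intro integrable_continuous_real psi_H_cont G sol_cont[OF sol])
  have 0: "integral {0..T} (\<lambda>x. \<psi> (c + H G u x)) = 0"
    using sol_V_T[OF sol] by (simp add: V_def)
  have "integral {0..T} (\<lambda>x. \<psi> (c - B)) \<le> integral {0..T} (\<lambda>x. \<psi> (c + H G u x))"
    by (intro integral_le int psi_mono) (use B in \<open>auto simp: abs_le_iff minus_le_iff\<close>)
  then have "\<psi> (c - B) \<le> 0"
    unfolding 0 using T_pos by (simp add: mult_le_0_iff)
  moreover have "integral {0..T} (\<lambda>x. \<psi> (c + H G u x)) \<le> integral {0..T} (\<lambda>x. \<psi> (c + B))"
    by (intro integral_le int psi_mono) (use B in \<open>auto simp: abs_le_iff\<close>)
  then have "0 \<le> \<psi> (c + B)"
    unfolding 0 using T_pos by (simp add: zero_le_mult_iff)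
  ultimately show ?thesis
    using psi_strict_mono[of 0 "c - B"] psi_strict_mono[of "c + B" 0] psi0 by force
qed

text \<open>Lets a solution be replaced by its clamped extension, which belongs to the compact set
  of functions.\<close>

lemma sol_cong_on:
  assumes sol: "sol G c u" and eq: "\<And>t. t \<in> {0..T} \<Longrightarrow> w t = u t"
  shows "sol G c w" "sig w = sig u"
proof -
  have P: "P w t = P u t" if "t \<in> {0..T}" for t
    unfolding P_def by (rule integral_cong) (use that eq in auto)
  show sig: "sig w = sig u"
    unfolding sig_def by (rule arg_cong[where f = "\<lambda>x. x / T"], rule integral_cong) (simp add: eq)
  have "H G w t = H G u t" if "t \<in> {0..T}" for t
    using that by (simp add: H_def sig P eq)
  then have V: "V G c w t = V G c u t" if "t \<in> {0..T}" for t
    unfolding V_def by (intro integral_cong) (use that in auto)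
  show "sol G c w"
    unfolding sol_def
  proof (intro conjI ballI)
    show "continuous_on {0..T} w"
      by (rule continuous_on_eq[OF sol_cont[OF sol] eq[symmetric]])
    show "V G c w T = 0"
      using V[of T] sol_V_T[OF sol] T_pos by simp
    show "w t = w 0 + V G c w t" if "t \<in> {0..T}" for t
      using eq[OF that] eq[of 0] V[OF that] sol_eq[OF sol that] T_pos by simp
  qed
qed

text \<open>A maximising sequence can be kept above some \<open>s1 > \<omega>\<close>. A solution
  lying wholly above \<open>N\<close> or wholly below \<open>-N\<close> would have a smaller
  parameter, so each one enters both remaining half-lines and the oscillation bound confines it.
  Bounds on the constants and a common Lipschitz constant follow, and a limit attains the
  supremum.\<close>

lemma exists_max_sol:
  assumes "sol F d v" "sig v > \<omega>"
  obtains c u where "sol F c u" "sig u > \<omega>" "\<And>c' u'. sol F c' u' \<Longrightarrow> sig u' \<le> sig u"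
proof -
  define S where "S = {sig u | c u. sol F c u}"
  have bdd: "bdd_above S"
    by (rule bdd_aboveI[of _ Q]) (use sig_bound sol_cont in \<open>fastforce simp: S_def abs_le_iff\<close>)
  have "sig v \<in> S"
    using assms(1) by (auto simp: S_def)
  define s0 where "s0 = Sup S"
  have le_s0: "sig u \<le> s0" if "sol F c u" for c u
    unfolding s0_def by (rule cSup_upper[OF _ bdd]) (use that in \<open>auto simp: S_def\<close>)
  have "s0 > \<omega>"
    using le_s0[OF assms(1)] assms(2) by simp
  define s1 where "s1 = (\<omega> + s0) / 2"
  have s1: "\<omega> < s1" "s1 < s0"
    using \<open>s0 > \<omega>\<close> by (auto simp: s1_def)
  have "\<exists>c u. sol F c u \<and> sig u > max s1 (s0 - 1 / real (Suc n))" for n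
  proof -
    have "max s1 (s0 - 1 / real (Suc n)) < Sup S"
      using s1 by (simp add: s0_def)
    then obtain x where "x \<in> S" "max s1 (s0 - 1 / real (Suc n)) < x"
      using less_cSup_iff[OF _ bdd] \<open>sig v \<in> S\<close> by blast
    then show ?thesis
      by (auto simp: S_def)
  qed
  then obtain C U where sol: "\<And>n. sol F (C n) (U n)" and sig: "\<And>n. sig (U n) > max s1 (s0 - 1 / real (Suc n))"
    by metis
  have U: "continuous_on {0..T} (U n)" for n
    using sol by (rule sol_cont)
  have sig_lim: "(\<lambda>n. sig (U n)) \<longlonglongrightarrow> s0"
  proof (rule real_tendsto_sandwich)
    show "(\<lambda>n. s0 - 1 / real (Suc n)) \<longlonglongrightarrow> s0"
      using tendsto_diff[OF tendsto_const LIMSEQ_inverse_real_of_nat, of s0] by (simp add: inverse_eq_divide)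
    show "\<forall>\<^sub>F n in sequentially. s0 - 1 / real (Suc n) \<le> sig (U n)"
      using sig by (auto simp: less_imp_le)
    show "\<forall>\<^sub>F n in sequentially. sig (U n) \<le> s0"
      using le_s0[OF sol] by auto
  qed (rule tendsto_const)
  obtain N where "N \<ge> 0"
    and N1: "\<And>w. continuous_on {0..T} w \<Longrightarrow> (\<And>t. t \<in> {0..T} \<Longrightarrow> w t \<ge> N) \<Longrightarrow> sig w < s1"
    and N2: "\<And>w. continuous_on {0..T} w \<Longrightarrow> (\<And>t. t \<in> {0..T} \<Longrightarrow> w t \<le> - N) \<Longrightarrow> sig w < s1"
    using sig_far[OF s1(1)] by blast
  define M where "M = N + osc"
  have UM: "\<bar>U n t\<bar> \<le> M" if t: "t \<in> {0..T}" for n t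
  proof -
    obtain t1 where t1: "t1 \<in> {0..T}" "U n t1 < N"
      using N1[OF U, of n] sig[of n] by force
    obtain t2 where t2: "t2 \<in> {0..T}" "U n t2 > - N"
      using N2[OF U, of n] sig[of n] by force
    show ?thesis
      using sol_oscillation[OF F_cont sol[of n] t1(1) t] sol_oscillation[OF F_cont sol[of n] t2(1) t] t1(2) t2(2)
      unfolding M_def by linarith
  qed
  have "bounded (F ` {-M..M})"
    by (intro compact_imp_bounded compact_continuous_image F_cont) auto
  then obtain bF where bF: "\<forall>u\<in>{-M..M}. \<bar>F u\<bar> \<le> bF"
    by (auto simp: bounded_iff)
  define B where "B = bH + bF"
  have HB: "\<bar>H F (U n) t\<bar> \<le> B" if t: "t \<in> {0..T}" for n t
  proof -
    have "\<bar>F (U n t)\<bar> \<le> bF"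
      using bF UM[OF t, of n] by (auto simp: abs_le_iff)
    then show ?thesis
      using H_G_bound[OF U t, of F n] by (simp add: B_def)
  qed
  have CB: "\<bar>C n\<bar> \<le> B" for n
    by (rule sol_const_bound[OF F_cont sol HB])
  define L where "L = max (\<psi> (2 * B)) (- \<psi> (- (2 * B)))"
  have U_lip: "\<bar>U n s - U n t\<bar> \<le> L * \<bar>s - t\<bar>" if "s \<in> {0..T}" "t \<in> {0..T}" for n s t
  proof -
    have "norm (U n s - U n t) \<le> L * norm (s - t)"
    proof (rule field_differentiable_bound[OF _ sol_deriv[OF F_cont sol] _ that])
      fix x assume "x \<in> {0..T}"
      then have "\<bar>C n + H F (U n) x\<bar> \<le> 2 * B"
        using HB[of x n] CB[of n] by linarith
      then show "norm (\<psi> (C n + H F (U n) x)) \<le> L"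
        unfolding real_norm_def L_def by (rule psi_abs_le)
    qed auto
    then show ?thesis
      by simp
  qed
  have "L \<ge> 0"
  proof -
    have "0 \<le> L * \<bar>0 - T\<bar>"
      by (rule order_trans[OF abs_ge_zero U_lip[of 0 T 0]]) (use T_pos in auto)
    then show ?thesis
      using T_pos by (simp add: zero_le_mult_iff)
  qed
  define cl where "cl t = max 0 (min T t)" for t
  have cl: "cl t \<in> {0..T}" for t
    using T_pos by (auto simp: cl_def)
  have cl_id: "cl t = t" if "t \<in> {0..T}" for t
    using that by (auto simp: cl_def)
  have bcont: "(\<lambda>t. U n (cl t)) \<in> bcontfun" for n
  proof -
    have "continuous_on UNIV (\<lambda>t. U n (cl t))"
      by (rule continuous_on_compose2[OF U]) (use cl in \<open>auto simp: cl_def intro!: continuous_intros\<close>)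
    moreover have "bounded (range (\<lambda>t. U n (cl t)))"
      unfolding bounded_iff using UM[OF cl] by auto
    ultimately show ?thesis
      by (simp add: bcontfun_def)
  qed
  define W where "W n = Bcontfun (\<lambda>t. U n (cl t))" for n
  have W: "apply_bcontfun (W n) t = U n (cl t)" for n t
    by (simp add: W_def Bcontfun_inverse bcont)
  have "W n \<in> clamped_lipschitz T M L" for n
  proof -
    have "\<bar>U n (cl s) - U n (cl t)\<bar> \<le> L * \<bar>s - t\<bar>" for s t
    proof -
      have "\<bar>U n (cl s) - U n (cl t)\<bar> \<le> L * \<bar>cl s - cl t\<bar>"
        by (rule U_lip[OF cl cl])
      also have "\<dots> \<le> L * \<bar>s - t\<bar>"
        using \<open>L \<ge> 0\<close> by (intro mult_left_mono) (auto simp: cl_def)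
      finally show ?thesis .
    qed
    then show ?thesis
      using UM[OF cl] by (simp add: clamped_lipschitz_def W cl_id[OF cl] flip: cl_def)
  qed
  then have CW: "\<forall>n. (C n, W n) \<in> {-B..B} \<times> clamped_lipschitz T M L"
    using CB by (auto simp: abs_le_iff minus_le_iff)
  have "seq_compact ({-B..B} \<times> clamped_lipschitz T M L)"
    using T_pos by (intro compact_imp_seq_compact compact_Times compact_clamped_lipschitz) auto
  then obtain x k where "x \<in> {-B..B} \<times> clamped_lipschitz T M L"
    and k: "strict_mono k" and lim: "((\<lambda>n. (C n, W n)) \<circ> k) \<longlonglongrightarrow> x"
    using CW by (rule seq_compactE)
  define c where "c = fst x"
  define w where "w = snd x"
  have C_lim: "(\<lambda>n. C (k n)) \<longlonglongrightarrow> c" and W_lim: "(\<lambda>n. W (k n)) \<longlonglongrightarrow> w"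
    using tendsto_fst[OF lim] tendsto_snd[OF lim] by (simp_all add: c_def w_def o_def)
  have ul: "uniform_limit {0..T} (\<lambda>n. apply_bcontfun (W (k n))) w sequentially"
    by (rule uniform_limit_on_subset[OF tendsto_bcontfun_uniform_limit[OF W_lim]]) auto
  note lims = uniform_limits[OF F_cont _ _ ul C_lim, simplified]
  have solW: "sol F (C n) (W n)" "sig (W n) = sig (U n)" for n
    using sol_cong_on[OF sol, of "W n" n] by (auto simp: W cl_id)
  have "(\<lambda>n. sig (W (k n))) \<longlonglongrightarrow> s0"
    using LIMSEQ_subseq_LIMSEQ[OF sig_lim k] by (simp add: solW(2) o_def)
  then have sig_w: "sig w = s0"
    using lims(1) LIMSEQ_unique by blast
  have V_lim: "(\<lambda>n. V F (C (k n)) (W (k n)) t) \<longlonglongrightarrow> V F c w t" if "t \<in> {0..T}" for t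
    by (rule tendsto_uniform_limitI[OF lims(2) that])
  have w_lim: "(\<lambda>n. W (k n) t) \<longlonglongrightarrow> w t" if "t \<in> {0..T}" for t
    by (rule tendsto_uniform_limitI[OF ul that])
  have "sol F c w"
    unfolding sol_def
  proof (intro conjI ballI)
    show "V F c w T = 0"
      using V_lim[of T] T_pos by (simp add: sol_V_T[OF solW(1)] LIMSEQ_const_iff)
    fix t assume t: "t \<in> {0..T}"
    have "(\<lambda>n. W (k n) 0 + V F (C (k n)) (W (k n)) t) \<longlonglongrightarrow> w 0 + V F c w t"
      using T_pos t by (intro tendsto_add w_lim V_lim) auto
    moreover have "W (k n) 0 + V F (C (k n)) (W (k n)) t = W (k n) t" for n
      by (rule sol_eq[OF solW(1) t, symmetric])
    ultimately show "w t = w 0 + V F c w t"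
      using w_lim[OF t] LIMSEQ_unique by simp
  qed simp
  then show thesis
    using that[of c w] sig_w \<open>s0 > \<omega>\<close> le_s0 by simp
qed

end

section \<open>Essentially bounded coefficients and conclusion\<close>

lemma Linf_on_integrable:
  assumes "Linf_on T g"
  shows "g integrable_on {0..T}"
proof -
  obtain B where B: "AE t in lebesgue. t \<in> {0..T} \<longrightarrow> \<bar>g t\<bar> \<le> B" and meas: "set_borel_measurable lebesgue {0..T} g"
    using assms by (auto simp: Linf_on_def)
  have "set_integrable lebesgue {0..T} g"
    unfolding set_integrable_def
  proof (rule Bochner_Integration.integrable_bound)
    show "integrable lebesgue (\<lambda>t. indicat_real {0..T} t *\<^sub>R B)"
      by (intro integrable_scaleR_left integrable_real_indicator) (auto simp: emeasure_lborel_Icc_eq)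
    show "(\<lambda>t. indicat_real {0..T} t *\<^sub>R g t) \<in> borel_measurable lebesgue"
      using meas by (simp add: set_borel_measurable_def)
    show "AE t in lebesgue. norm (indicat_real {0..T} t *\<^sub>R g t) \<le> norm (indicat_real {0..T} t *\<^sub>R B)"
      using B by eventually_elim (auto simp: indicator_def)
  qed
  then show ?thesis
    by (rule set_lebesgue_integral_eq_integral)
qed

lemma periodic_solution_AE_cong:
  assumes "AE t in lebesgue. t \<in> {0..T} \<longrightarrow> a t = a' t" "AE t in lebesgue. t \<in> {0..T} \<longrightarrow> e t = e' t"
    and "periodic_solution \<phi> f a q e T s u"
  shows "periodic_solution \<phi> f a' q e' T s u"
proof -
  obtain u' where *: "\<forall>t\<in>{0..T}. (u has_real_derivative u' t) (at t within {0..T})"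
     "continuous_on {0..T} u'" "u 0 = u T" "u' 0 = u' T" "abs_continuous_on {0..T} (\<lambda>t. \<phi> (u' t))"
    and ae: "AE t in lebesgue. t \<in> {0..T} \<longrightarrow> ((\<lambda>t. \<phi> (u' t)) has_real_derivative
                 (s + e t - f (u t) * u' t - a t * q (u t))) (at t within {0..T})"
    using assms(3) unfolding periodic_solution_def by blast
  have "AE t in lebesgue. t \<in> {0..T} \<longrightarrow> ((\<lambda>t. \<phi> (u' t)) has_real_derivative
                 (s + e' t - f (u t) * u' t - a' t * q (u t))) (at t within {0..T})"
    using ae assms(1,2) by eventually_elim simp
  with * show ?thesis
    unfolding periodic_solution_def by blast
qed

theorem theorem1p2:
  fixes T :: real and \<phi> f q a e :: "real \<Rightarrow> real" and \<omega> :: real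
  assumes T_pos: "T > 0"
    and phi_mono: "strict_mono \<phi>"
    and phi_homeo: "\<exists>\<psi>. homeomorphism UNIV UNIV \<phi> \<psi>"
    and phi0: "\<phi> 0 = 0"
    and f_cont: "continuous_on UNIV f"
    and q_cont: "continuous_on UNIV q"
    and a_Linf: "Linf_on T a"
    and e_Linf: "Linf_on T e"
    and a_nonneg: "AE t in lebesgue. t \<in> {0..T} \<longrightarrow> a t \<ge> 0"
    and a_mean: "(1 / T) * integral {0..T} a = 1"
    and e_mean: "(1 / T) * integral {0..T} e = 0"
    and q_bot: "(q \<longlongrightarrow> \<omega>) at_bot"
    and q_top: "(q \<longlongrightarrow> \<omega>) at_top"
    and q_large: "\<exists>R. \<forall>u. \<bar>u\<bar> \<ge> R \<longrightarrow> q u > \<omega>"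
  shows "\<exists>s0 > \<omega>.
     (\<forall>s > s0. \<not> (\<exists>u. periodic_solution \<phi> f a q e T s u)) \<and>
     (\<exists>u. periodic_solution \<phi> f a q e T s0 u) \<and>
     (\<forall>s. \<omega> < s \<and> s < s0 \<longrightarrow>
        (\<exists>u1 u2. periodic_solution \<phi> f a q e T s u1 \<and> periodic_solution \<phi> f a q e T s u2 \<and>
                 (\<exists>t\<in>{0..T}. u1 t \<noteq> u2 t))) \<and>
     ((\<forall>u. q u > \<omega>) \<longrightarrow> (\<forall>s \<le> \<omega>. \<not> (\<exists>u. periodic_solution \<phi> f a q e T s u)))"
proof -
  obtain \<psi> where \<psi>: "homeomorphism UNIV UNIV \<phi> \<psi>"
    using phi_homeo by blast
  obtain F where F: "\<And>u. (F has_real_derivative f u) (at u)"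
    using antiderivative_UNIV[OF f_cont] by blast
  obtain A1 where A1: "AE t in lebesgue. t \<in> {0..T} \<longrightarrow> \<bar>a t\<bar> \<le> A1"
    using a_Linf by (auto simp: Linf_on_def)
  obtain A2 where A2: "AE t in lebesgue. t \<in> {0..T} \<longrightarrow> \<bar>e t\<bar> \<le> A2"
    using e_Linf by (auto simp: Linf_on_def)
  define A where "A = max 0 (max A1 A2)"
  have "AE t in lebesgue. t \<in> {0..T} \<longrightarrow> 0 \<le> a t \<and> a t \<le> A \<and> \<bar>e t\<bar> \<le> A"
    using a_nonneg A1 A2 by eventually_elim (auto simp: A_def)
  then obtain N where N: "negligible N"
    and good: "{t. \<not> (t \<in> {0..T} \<longrightarrow> 0 \<le> a t \<and> a t \<le> A \<and> \<bar>e t\<bar> \<le> A)} \<subseteq> N"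
    unfolding eventually_ae_filter negligible_iff_null_sets by auto
  \<comment> \<open>The value 0 satisfies all the pointwise bounds, since \<open>A\<close> is
    nonnegative.\<close>
  define a' where "a' t = (if t \<in> N then 0 else a t)" for t
  define e' where "e' t = (if t \<in> N then 0 else e t)" for t
  have AE_N: "AE t in lebesgue. t \<notin> N"
    using N unfolding negligible_iff_null_sets by (rule AE_not_in)
  have aa': "AE t in lebesgue. t \<in> {0..T} \<longrightarrow> a t = a' t" and ee': "AE t in lebesgue. t \<in> {0..T} \<longrightarrow> e t = e' t"
    using AE_N by (auto simp: a'_def e'_def elim: eventually_mono)
  have iff: "periodic_solution \<phi> f a q e T s u \<longleftrightarrow> periodic_solution \<phi> f a' q e' T s u" for s u
  proof
    show "periodic_solution \<phi> f a q e T s u \<Longrightarrow> periodic_solution \<phi> f a' q e' T s u"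
      by (rule periodic_solution_AE_cong[OF aa' ee'])
    show "periodic_solution \<phi> f a' q e' T s u \<Longrightarrow> periodic_solution \<phi> f a q e T s u"
      by (rule periodic_solution_AE_cong) (use aa' ee' in \<open>auto elim: eventually_mono\<close>)
  qed
  have ints: "a' integrable_on {0..T}" "e' integrable_on {0..T}"
    by (rule integrable_spike[OF Linf_on_integrable[OF a_Linf] N], simp add: a'_def)
      (rule integrable_spike[OF Linf_on_integrable[OF e_Linf] N], simp add: e'_def)
  have means: "integral {0..T} a' = T" "integral {0..T} e' = 0"
    using integral_spike[OF N, of "{0..T}" a' a] integral_spike[OF N, of "{0..T}" e' e] a_mean e_mean T_pos
    by (auto simp: a'_def e'_def field_simps)
  have "A \<ge> 0"
    by (simp add: A_def)
  have \<psi>': "\<phi> (\<psi> x) = x" "\<psi> (\<phi> x) = x" "continuous_on UNIV \<psi>" for x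
    using \<psi> by (auto simp: homeomorphism_def)
  interpret weighted_lienard T A \<omega> \<phi> \<psi> f F q a' e'
  proof
    show "0 \<le> a' t \<and> a' t \<le> A" "\<bar>e' t\<bar> \<le> A" if "t \<in> {0..T}" for t
      using good that \<open>A \<ge> 0\<close> by (auto simp: a'_def e'_def)
  qed (fact T_pos phi_mono phi0 \<psi>' f_cont F q_cont q_bot q_top ints means)+
  have sol_iff: "(\<exists>u. periodic_solution \<phi> f a q e T s u) \<longleftrightarrow> (\<exists>c u. sol F c u \<and> sig u = s)" for s
    unfolding iff using periodic_solution_imp_sol sol_imp_periodic_solution by metis
  obtain d v where "sol F d v" "sig v > \<omega>"
    using exists_sol_above[OF q_large] by blast
  then obtain c u where u: "sol F c u" "sig u > \<omega>" and max: "\<And>c' u'. sol F c' u' \<Longrightarrow> sig u' \<le> sig u"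
    using exists_max_sol by blast
  show ?thesis
  proof (intro exI[of _ "sig u"] conjI allI impI)
    show "\<not> (\<exists>u. periodic_solution \<phi> f a q e T s u)" if "s > sig u" for s
      unfolding sol_iff using max that by fastforce
    show "\<exists>u'. periodic_solution \<phi> f a q e T (sig u) u'"
      unfolding sol_iff using u by blast
    show "\<exists>u1 u2. periodic_solution \<phi> f a q e T s u1 \<and> periodic_solution \<phi> f a q e T s u2 \<and>
        (\<exists>t\<in>{0..T}. u1 t \<noteq> u2 t)" if s: "\<omega> < s \<and> s < sig u" for s
    proof -
      obtain c1 u1 c2 u2 t where "sol F c1 u1" "sig u1 = s" "sol F c2 u2" "sig u2 = s" "t \<in> {0..T}" "u1 t \<noteq> u2 t"
        using two_solutions[OF u(1), of s] s by blast
      then show ?thesis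
        unfolding iff using sol_imp_periodic_solution by metis
    qed
    show "\<not> (\<exists>u. periodic_solution \<phi> f a q e T s u)" if "\<forall>u. q u > \<omega>" "s \<le> \<omega>" for s
      unfolding sol_iff using sig_gt[OF sol_cont] that by fastforce
  qed (rule u(2))
qed

end
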